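(* Let $\mathcal{M}\subset\mathbb{R}^{n_p}$ be a smooth (boundaryless) manifold properly embedded in $\mathbb{R}^{n_p}$ with the induced Riemannian metric, let $p^\star\in\mathcal{M}$, and let $b_1,\dots,b_r$ be $\mathcal{C}^1$ vector fields with $b_i(p)\in T_p\mathcal{M}$ for all $p\in\mathcal{M}$, such that for some $\lambda>0$, $\sum_{i=1}^r\langle b_i(p),v\rangle^2\ge\lambda\langle v,v\rangle$ for all $p\in\mathcal{M}$ and $v\in T_p\mathcal{M}$. Let $\{V_q\}_{q\in\mathcal{Q}}$, $\mathcal{Q}=\{1,\dots,N\}$, be a $\delta$-gap synergistic family of potential functions with respect to $p^\star$. Let $\mathcal{H}$ be the hybrid system on $\mathcal{M}\times\mathcal{Q}\times\Theta$ constructed in the context (plant $\dot p=\sum_ib_i(p)\theta_iu_i$, switching control gains $\theta$, synergistic switching of the logic state $q$), and let $V(x)=V_q(p)$ for $x=(p,q)$. Then $\mathcal{H}$ is strongly $\nabla V$-stabilizable with this $V$ and $\mathcal{A}=\{p^\star\}\times\mathcal{Q}$: $V$ is a strong control Lyapunov function candidate with respect to $\mathcal{A}$ for $\mathcal{H}$, and $\mathcal{A}\times\Theta$ is UGAS for the corresponding ideal closed-loop system $\mathcal{H}_V$.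
   Context: **Hybrid systems.** A hybrid system is $\dot z\in F(z)$ for $z\in C$, $z^+\in G(z)$ for $z\in D$. A compact hybrid time domain is a set $\bigcup_{j=0}^{J-1}([t_j,t_{j+1}]\times\{j\})$ with $0=t_0\le t_1\le\dots\le t_J$. A hybrid time domain is a set $E\subset\mathbb{R}_{\ge0}\times\mathbb{Z}_{\ge0}$ such that $E\cap([0,T]\times\{0,\dots,J\})$ is a compact hybrid time domain for every $(T,J)\in E$. A solution is a function $z$ on a hybrid time domain $\mathrm{dom}(z)$, with $z(\cdot,j)$ locally absolutely continuous on $I_j=\{t:(t,j)\in\mathrm{dom}(z)\}$ whenever $I_j$ has nonempty interior, such that: $z(0,0)\in C\cup D$; if $I_j$ has nonempty interior, then $z(t,j)\in C$ for all $t\in I_j$ and $\dot z(t,j)\in F(z(t,j))$ for a.e. $t\in I_j$; if $(t,j),(t,j+1)\in\mathrm{dom}(z)$, then $z(t,j)\in D$ and $z(t,j+1)\in G(z(t,j))$. Solutions need not be complete. Write $|z|_K=\min_{w\in K}\|z-w\|_2$. A class $\mathcal{KL}$ function $\beta:\mathbb{R}_{\ge0}^2\to\mathbb{R}_{\ge0}$ is nondecreasing in the first argument, nonincreasing in the second, with $\lim_{r\to0^+}\beta(r,s)=0$ for each $s$ and $\lim_{s\to\infty}\beta(r,s)=0$ for each $r$. A compact set $K_0$ is *UGAS* if there is $\beta\in\mathcal{KL}$ such that every solution satisfies $|z(t,j)|_{K_0}\le\beta(|z(0,0)|_{K_0},t+j)$ for all $(t,j)\in\mathrm{dom}(z)$.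 A map is $\mathcal{C}^1$ if it is continuously differentiable with locally Lipschitz derivative. **Synergistic families.** For a $\mathcal{C}^1$ function $W$ on $\mathcal{M}$, $\mathrm{Crit}(W)=\{p\in\mathcal{M}:\nabla W(p)\in(T_p\mathcal{M})^\perp\}$ (gradient of any local $\mathcal{C}^1$ extension to the ambient space). A family of $\mathcal{C}^1$ functions $V_q:\mathcal{M}\to\mathbb{R}_{\ge0}$, $q\in\mathcal{Q}=\{1,\dots,N\}$, $N\ge1$, is a *$\delta$-gap synergistic family of potential functions with respect to $p^\star$* if for all $q\in\mathcal{Q}$: (1) $V_q$ is positive definite with respect to $p^\star$; (2) $\{p\in\mathcal{M}:V_q(p)\le c\}$ is compact for all $c\ge0$; (3) there is an open neighborhood $\mathcal{U}_q\subset\mathbb{R}^{n_p}$ of $p^\star$ with $\mathcal{U}_q\cap\mathrm{Crit}(V_q)=\{p^\star\}$; and (4) $\delta>0$ satisfies $\delta<\Delta^\star$, where $$\Delta^\star=\min_{q\in\mathcal{Q},\;p\in\mathrm{Crit}(V_q)\setminus\{p^\star\}}\Big(V_q(p)-\min_{\tilde q\in\mathcal{Q}}V_{\tilde q}(p)\Big)$$ (understood as an infimum, equal to $+\infty$ if there is no such $p$). **Control gains.** $\mathcal{E}\subset\mathbb{R}^r$ is a finite set (e.g. $\{+1,0,-1\}^r$) with at least two elements. Fix $T_\circ>0$, $\chi_1>0$, $\chi_2\in(0,1)$. The state $\theta=(\theta_1,\dots,\theta_r,\theta_{r+1},\theta_{r+2})$ evolves by $\dot\theta\in F_e(\theta)$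 for $\theta\in\Theta_C=\mathcal{E}\times[0,1]\times[0,T_\circ]$ and $\theta^+\in G_e(\theta)$ for $\theta\in\Theta_D=\mathcal{E}\times\{1\}\times[0,T_\circ]$, where $$F_e(\theta)=\{0\}\times[0,\chi_1]\times\big([0,\chi_2]-\mathbb{I}_{\mathcal{E}_b}(\theta)\big),\qquad G_e(\theta)=\big(\mathcal{E}\setminus\{(\theta_1,\dots,\theta_r)\}\big)\times\{0\}\times\{\theta_{r+2}\},$$ $\mathcal{E}_b=\{\theta:\exists i\in\{1,\dots,r\},\ \theta_i=0\}$ and $\mathbb{I}_{\mathcal{E}_b}$ is its indicator function. Let $\Theta=\Theta_C\cup\Theta_D$. **System $\mathcal{H}$.** With $x=(p,q)\in\mathcal{M}\times\mathcal{Q}$ and $\mu(x)=V_q(p)-\min_{\tilde q\in\mathcal{Q}}V_{\tilde q}(p)$, let $\mathcal{X}_C=\{x\in\mathcal{M}\times\mathcal{Q}:\mu(x)\le\delta\}$, $\mathcal{X}_D=\{x\in\mathcal{M}\times\mathcal{Q}:\mu(x)\ge\delta\}$, $G_{\mathcal{X}}(x)=\{p\}\times\arg\min_{\tilde q\in\mathcal{Q}}V_{\tilde q}(p)$, $f_0=0$, $f_i(x,\theta)=\theta_i(b_i(p),0)$ (so $\dot q=0$ in flows), and $\mathcal{X}=\mathcal{X}_C\cup\mathcal{X}_D$. Then $\mathcal{H}$ has state $\xi=(x,\theta)$, flow set $C=\mathcal{X}_C\times\Theta_C$, flow map $\{f_0(x,\theta)+\sum_if_i(x,\theta)u_i\}\times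 F_e(\theta)$ with input $u\in\mathbb{R}^r$, jump set $D=(\mathcal{X}_C\times\Theta_D)\cup(\mathcal{X}_D\times\Theta_C)\cup(\mathcal{X}_D\times\Theta_D)$, and jump map $G(\xi)$ equal to $G_{\mathcal{X}}(x)\times G_e(\theta)$ on $\mathcal{X}_D\times\Theta_D$, $\{x\}\times G_e(\theta)$ on $\mathcal{X}_C\times\Theta_D$, $G_{\mathcal{X}}(x)\times\{\theta\}$ on $\mathcal{X}_D\times\Theta_C$ (the union of the applicable sets where these cases overlap). **SCLF candidate.** $V$ is a strong control Lyapunov function candidate with respect to the compact set $\mathcal{A}$ for $\mathcal{H}$ if there are $\gamma>0$ and $\alpha_1,\alpha_2\in\mathcal{K}_\infty$ with: (a) $\alpha_1(|x|_{\mathcal{A}})\le V(x)\le\alpha_2(|x|_{\mathcal{A}})$ for $x\in\mathcal{X}$; (b) $\langle\nabla V(x),\bar f(\xi)\rangle\le0$ for $\xi\in C$, where $\bar f(\xi)=f_0(x,\theta)-\gamma\sum_{i=1}^r\langle\nabla V(x),f_i(x,\theta)\rangle f_i(x,\theta)$; (c) $\max_{(x',\theta')\in G(\xi)}V(x')-V(x)\le0$ for $\xi=(x,\theta)\in D$. Here $\langle\nabla V(x),f_i(x,\theta)\rangle=\theta_i\langle\nabla V_q(p),b_i(p)\rangle$. The ideal closed-loop system $\mathcal{H}_V$ is: $\dot\xi\in\{\bar f(\xi)\}\times F_e(\theta)$ for $\xi\in C$, $\xi^+\in G(\xi)$ for $\xi\in D$. *)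

theory Defs
  imports "HOL-Analysis.Analysis"
begin

section \<open>Hybrid systems\<close>

record 'z hybrid_system =
  flow_set :: "'z set"
  flow_map :: "'z \<Rightarrow> 'z set"
  jump_set :: "'z set"
  jump_map :: "'z \<Rightarrow> 'z set"

definition compact_hybrid_time_domain :: "(real \<times> nat) set \<Rightarrow> bool" where
  "compact_hybrid_time_domain E \<longleftrightarrow>
     (\<exists>(J::nat) \<tau>::nat \<Rightarrow> real. \<tau> 0 = 0 \<and> (\<forall>j<J. \<tau> j \<le> \<tau> (Suc j)) \<and>
        E = (\<Union>j<J. {\<tau> j..\<tau> (Suc j)} \<times> {j}))"

definition hybrid_time_domain :: "(real \<times> nat) set \<Rightarrow> bool" where
  "hybrid_time_domain E \<longleftrightarrow> E \<subseteq> {0..} \<times> UNIV \<and>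
     (\<forall>(T, J)\<in>E. compact_hybrid_time_domain (E \<inter> ({0..T} \<times> {0..J})))"

definition abs_continuous_on :: "real set \<Rightarrow> (real \<Rightarrow> 'a::real_normed_vector) \<Rightarrow> bool" where
  "abs_continuous_on S f \<longleftrightarrow>
     (\<forall>\<epsilon>>0. \<exists>d>0. \<forall>\<D> K. \<D> division_of K \<and> K \<subseteq> S \<and> (\<Sum>k\<in>\<D>. Sup k - Inf k) < d \<longrightarrow>
        (\<Sum>k\<in>\<D>. norm (f (Sup k) - f (Inf k))) < \<epsilon>)"

definition loc_abs_continuous_on :: "real set \<Rightarrow> (real \<Rightarrow> 'a::real_normed_vector) \<Rightarrow> bool" where
  "loc_abs_continuous_on I f \<longleftrightarrow> (\<forall>a b. {a..b} \<subseteq> I \<longrightarrow> abs_continuous_on {a..b} f)"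

text \<open>A solution is a pair of a hybrid time domain \<open>E\<close> and a map \<open>z\<close> of which only the
  values on \<open>E\<close> matter. Solutions need be neither complete nor maximal.\<close>

definition hybrid_solution ::
  "'z::real_normed_vector hybrid_system \<Rightarrow> (real \<times> nat) set \<Rightarrow> (real \<Rightarrow> nat \<Rightarrow> 'z) \<Rightarrow> bool" where
  "hybrid_solution H E z \<longleftrightarrow>
     hybrid_time_domain E \<and> (0, 0) \<in> E \<and> z 0 0 \<in> flow_set H \<union> jump_set H \<and>
     (\<forall>j. let I = {t. (t, j) \<in> E} in interior I \<noteq> {} \<longrightarrow>
        loc_abs_continuous_on I (\<lambda>t. z t j) \<and>
        (\<forall>t\<in>I. z t j \<in> flow_set H) \<and>
        (AE t in lebesgue. t \<in> I \<longrightarrow>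
           (\<exists>v\<in>flow_map H (z t j). ((\<lambda>s. z s j) has_vector_derivative v) (at t within I)))) \<and>
     (\<forall>t j. (t, j) \<in> E \<and> (t, Suc j) \<in> E \<longrightarrow>
        z t j \<in> jump_set H \<and> z t (Suc j) \<in> jump_map H (z t j))"

definition class_KL :: "(real \<Rightarrow> real \<Rightarrow> real) \<Rightarrow> bool" where
  "class_KL \<beta> \<longleftrightarrow>
     (\<forall>r\<ge>0. \<forall>s\<ge>0. 0 \<le> \<beta> r s) \<and>
     (\<forall>s\<ge>0. mono_on {0..} (\<lambda>r. \<beta> r s)) \<and>
     (\<forall>r\<ge>0. antimono_on {0..} (\<beta> r)) \<and>
     (\<forall>s\<ge>0. ((\<lambda>r. \<beta> r s) \<longlongrightarrow> 0) (at_right 0)) \<and>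
     (\<forall>r\<ge>0. (\<beta> r \<longlongrightarrow> 0) at_top)"

definition class_K_inf :: "(real \<Rightarrow> real) \<Rightarrow> bool" where
  "class_K_inf \<alpha> \<longleftrightarrow>
     continuous_on {0..} \<alpha> \<and> strict_mono_on {0..} \<alpha> \<and> \<alpha> 0 = 0 \<and> filterlim \<alpha> at_top at_top"

definition UGAS :: "'z::euclidean_space hybrid_system \<Rightarrow> 'z set \<Rightarrow> bool" where
  "UGAS H K \<longleftrightarrow> compact K \<and>
     (\<exists>\<beta>. class_KL \<beta> \<and>
       (\<forall>E z. hybrid_solution H E z \<longrightarrow>
          (\<forall>(t, j)\<in>E. infdist (z t j) K \<le> \<beta> (infdist (z 0 0) K) (t + real j))))"


section \<open>Embedded manifolds and functions on them\<close>

primrec higher_differentiable_on ::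
  "'a::real_normed_vector set \<Rightarrow> ('a \<Rightarrow> 'b::real_normed_vector) \<Rightarrow> nat \<Rightarrow> bool" where
  "higher_differentiable_on U f 0 \<longleftrightarrow> continuous_on U f"
| "higher_differentiable_on U f (Suc k) \<longleftrightarrow> (\<forall>x\<in>U. f differentiable (at x)) \<and>
     (\<forall>v. higher_differentiable_on U (\<lambda>x. frechet_derivative f (at x) v) k)"

definition smooth_on ::
  "'a::real_normed_vector set \<Rightarrow> ('a \<Rightarrow> 'b::real_normed_vector) \<Rightarrow> bool" where
  "smooth_on U f \<longleftrightarrow> (\<forall>k. higher_differentiable_on U f k)"

text \<open>Smooth boundaryless embedded submanifold of dimension \<open>k\<close>: around each point a smooth
  diffeomorphism of open subsets of the ambient space flattens \<open>M\<close> to a \<open>k\<close>-dimensional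
  linear subspace.\<close>

definition embedded_submanifold :: "nat \<Rightarrow> 'a::euclidean_space set \<Rightarrow> bool" where
  "embedded_submanifold k M \<longleftrightarrow>
     (\<forall>p\<in>M. \<exists>U (W::'a set) \<phi> \<psi> S. open U \<and> p \<in> U \<and> open W \<and> homeomorphism U W \<phi> \<psi> \<and>
        smooth_on U \<phi> \<and> smooth_on W \<psi> \<and>
        subspace S \<and> dim S = k \<and> \<phi> ` (U \<inter> M) = W \<inter> S)"

text \<open>For an embedded submanifold, being properly embedded amounts to being closed.\<close>

definition properly_embedded_manifold :: "'a::euclidean_space set \<Rightarrow> bool" where
  "properly_embedded_manifold M \<longleftrightarrow> closed M \<and> (\<exists>k. embedded_submanifold k M)"

definition tangent_space :: "'a::euclidean_space set \<Rightarrow> 'a \<Rightarrow> 'a set" where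
  "tangent_space M p =
     {v. \<exists>c e. 0 < e \<and> c C1_differentiable_on {-e<..<e} \<and> c ` {-e<..<e} \<subseteq> M \<and> c 0 = p \<and>
           (c has_vector_derivative v) (at 0)}"

text \<open>Here \<open>C\<^sup>1\<close> means differentiable with \<^emph>\<open>locally Lipschitz\<close> (hence continuous) derivative.
  A function on a subset of the ambient space is \<open>C\<^sup>1\<close> if it locally extends to such a
  function on an open set.\<close>

definition C1_open :: "'a::euclidean_space set \<Rightarrow> ('a \<Rightarrow> 'b::euclidean_space) \<Rightarrow> bool" where
  "C1_open U f \<longleftrightarrow> open U \<and>
     (\<exists>f'. (\<forall>x\<in>U. (f has_derivative blinfun_apply (f' x)) (at x)) \<and>
           (\<forall>x\<in>U. \<exists>e>0. \<exists>L. L-lipschitz_on (ball x e \<inter> U) f'))"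

definition local_C1_extension ::
  "'a::euclidean_space set \<Rightarrow> ('a \<Rightarrow> 'b::euclidean_space) \<Rightarrow> 'a \<Rightarrow> 'a set \<Rightarrow> ('a \<Rightarrow> 'b) \<Rightarrow> bool" where
  "local_C1_extension X f x U g \<longleftrightarrow> x \<in> U \<and> C1_open U g \<and> (\<forall>y\<in>U \<inter> X. g y = f y)"

definition C1_fun_on :: "'a::euclidean_space set \<Rightarrow> ('a \<Rightarrow> 'b::euclidean_space) \<Rightarrow> bool" where
  "C1_fun_on X f \<longleftrightarrow> (\<forall>x\<in>X. \<exists>U g. local_C1_extension X f x U g)"

text \<open>The ambient gradient at \<open>x\<close> of an arbitrary local \<open>C\<^sup>1\<close> extension of \<open>W\<close>. Only its
  component tangent to \<open>X\<close> is independent of the extension; below it is paired only with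
  vectors tangent to \<open>X\<close>.\<close>

definition nabla :: "'a::euclidean_space set \<Rightarrow> ('a \<Rightarrow> real) \<Rightarrow> 'a \<Rightarrow> 'a" where
  "nabla X W x =
     (SOME v. \<exists>U g. local_C1_extension X W x U g \<and> (g has_derivative (\<lambda>h. v \<bullet> h)) (at x))"

definition Crit :: "'a::euclidean_space set \<Rightarrow> ('a \<Rightarrow> real) \<Rightarrow> 'a set" where
  "Crit M W = {p \<in> M. nabla M W p \<in> orthogonal_comp (tangent_space M p)}"


section \<open>Strong control Lyapunov functions\<close>

text \<open>An input-affine hybrid system with state \<open>\<xi> = (x, \<theta>)\<close>, flow map
  \<open>{f\<^sub>0(\<xi>) + \<Sum>\<^sub>i u\<^sub>i f\<^sub>i(\<xi>)} \<times> F\<^sub>e(\<theta>)\<close> and input-free jumps; \<open>x_space\<close> and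
  \<open>gain_space\<close> are the sets in which \<open>x\<close> and \<open>\<theta>\<close> take values.\<close>

record ('x, 'e, 'r) control_system =
  x_space :: "'x set"
  gain_space :: "'e set"
  drift :: "'x \<times> 'e \<Rightarrow> 'x"
  ctrl :: "'r \<Rightarrow> 'x \<times> 'e \<Rightarrow> 'x"
  gain_flow :: "'e \<Rightarrow> 'e set"
  c_flow_set :: "('x \<times> 'e) set"
  c_jump_set :: "('x \<times> 'e) set"
  c_jump_map :: "'x \<times> 'e \<Rightarrow> ('x \<times> 'e) set"

definition input_flow_map ::
  "('x::euclidean_space, 'e, 'r::finite) control_system \<Rightarrow> real ^ 'r \<Rightarrow> 'x \<times> 'e \<Rightarrow> ('x \<times> 'e) set" where
  "input_flow_map S u \<xi> =
     {drift S \<xi> + (\<Sum>i\<in>UNIV. (u $ i) *\<^sub>R ctrl S i \<xi>)} \<times> gain_flow S (snd \<xi>)"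

definition ideal_field ::
  "('x::euclidean_space, 'e, 'r::finite) control_system \<Rightarrow> ('x \<Rightarrow> real) \<Rightarrow> real \<Rightarrow> 'x \<times> 'e \<Rightarrow> 'x" where
  "ideal_field S V \<gamma> \<xi> =
     drift S \<xi> -
     \<gamma> *\<^sub>R (\<Sum>i\<in>UNIV. (nabla (x_space S) V (fst \<xi>) \<bullet> ctrl S i \<xi>) *\<^sub>R ctrl S i \<xi>)"

definition ideal_closed_loop ::
  "('x::euclidean_space, 'e, 'r::finite) control_system \<Rightarrow> ('x \<Rightarrow> real) \<Rightarrow> real \<Rightarrow>
   ('x \<times> 'e) hybrid_system" where
  "ideal_closed_loop S V \<gamma> =
     \<lparr>flow_set = c_flow_set S,
      flow_map = (\<lambda>\<xi>. {ideal_field S V \<gamma> \<xi>} \<times> gain_flow S (snd \<xi>)),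
      jump_set = c_jump_set S,
      jump_map = c_jump_map S\<rparr>"

lemma ideal_closed_loop_feedback:
  "flow_map (ideal_closed_loop S V \<gamma>) \<xi> =
     input_flow_map S (\<chi> i. - \<gamma> * (nabla (x_space S) V (fst \<xi>) \<bullet> ctrl S i \<xi>)) \<xi>"
  by (simp add: ideal_closed_loop_def input_flow_map_def ideal_field_def
      scaleR_sum_right sum_negf)

text \<open>The gain \<open>\<gamma>\<close> is exposed because the ideal closed loop depends on it.\<close>

definition sclf_candidate ::
  "('x::euclidean_space, 'e, 'r::finite) control_system \<Rightarrow> ('x \<Rightarrow> real) \<Rightarrow> 'x set \<Rightarrow> real \<Rightarrow> bool" where
  "sclf_candidate S V A \<gamma> \<longleftrightarrow> compact A \<and> \<gamma> > 0 \<and> C1_fun_on (x_space S) V \<and>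
     (\<exists>\<alpha>\<^sub>1 \<alpha>\<^sub>2. class_K_inf \<alpha>\<^sub>1 \<and> class_K_inf \<alpha>\<^sub>2 \<and>
        (\<forall>x\<in>x_space S. \<alpha>\<^sub>1 (infdist x A) \<le> V x \<and> V x \<le> \<alpha>\<^sub>2 (infdist x A))) \<and>
     (\<forall>\<xi>\<in>c_flow_set S. nabla (x_space S) V (fst \<xi>) \<bullet> ideal_field S V \<gamma> \<xi> \<le> 0) \<and>
     (\<forall>(x, \<theta>)\<in>c_jump_set S. \<forall>(x', \<theta>')\<in>c_jump_map S (x, \<theta>). V x' - V x \<le> 0)"

definition strongly_grad_stabilizable ::
  "('x::euclidean_space, 'e::euclidean_space, 'r::finite) control_system \<Rightarrow>
   ('x \<Rightarrow> real) \<Rightarrow> 'x set \<Rightarrow> bool" where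
  "strongly_grad_stabilizable S V A \<longleftrightarrow>
     (\<exists>\<gamma>. sclf_candidate S V A \<gamma> \<and> UGAS (ideal_closed_loop S V \<gamma>) (A \<times> gain_space S))"


section \<open>Synergistic potential functions\<close>

text \<open>The logic variable is part of the hybrid state, which lives in a Euclidean space, so
  \<open>{1, \<dots>, N}\<close> is taken as a set of reals and families \<open>V\<^sub>q\<close> are indexed by reals; only the
  members with index in this set are ever used.\<close>

definition modes :: "nat \<Rightarrow> real set" where
  "modes N = real ` {1..N}"

definition synergy_gap :: "nat \<Rightarrow> (real \<Rightarrow> 'p \<Rightarrow> real) \<Rightarrow> 'p \<times> real \<Rightarrow> real" where
  "synergy_gap N V = (\<lambda>(p, q). V q p - Min ((\<lambda>q'. V q' p) ` modes N))"

text \<open>In \<^typ>\<open>ereal\<close> the infimum over the empty set is \<open>\<infinity>\<close>.\<close>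

definition gap_bound ::
  "'p::euclidean_space set \<Rightarrow> 'p \<Rightarrow> nat \<Rightarrow> (real \<Rightarrow> 'p \<Rightarrow> real) \<Rightarrow> ereal" where
  "gap_bound M p\<^sub>0 N V =
     (INF (p, q)\<in>{(p, q). q \<in> modes N \<and> p \<in> Crit M (V q) - {p\<^sub>0}}. ereal (synergy_gap N V (p, q)))"

definition synergistic_family ::
  "'p::euclidean_space set \<Rightarrow> 'p \<Rightarrow> nat \<Rightarrow> (real \<Rightarrow> 'p \<Rightarrow> real) \<Rightarrow> real \<Rightarrow> bool" where
  "synergistic_family M p\<^sub>0 N V \<delta> \<longleftrightarrow> N \<ge> 1 \<and>
     (\<forall>q\<in>modes N.
        C1_fun_on M (V q) \<and> (\<forall>p\<in>M. 0 \<le> V q p) \<and>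
        V q p\<^sub>0 = 0 \<and> (\<forall>p\<in>M - {p\<^sub>0}. 0 < V q p) \<and>
        (\<forall>c\<ge>0. compact {p \<in> M. V q p \<le> c}) \<and>
        (\<exists>U. open U \<and> p\<^sub>0 \<in> U \<and> U \<inter> Crit M (V q) = {p\<^sub>0})) \<and>
     0 < \<delta> \<and> ereal \<delta> < gap_bound M p\<^sub>0 N V"


section \<open>The system with switching control gains and synergistic mode switching\<close>

text \<open>The gain state \<open>\<theta> = (\<theta>\<^sub>1, \<dots>, \<theta>\<^sub>r, \<theta>\<^bsub>r+1\<^esub>, \<theta>\<^bsub>r+2\<^esub>)\<close> is grouped as
  \<open>((\<theta>\<^sub>1, \<dots>, \<theta>\<^sub>r), \<theta>\<^bsub>r+1\<^esub>, \<theta>\<^bsub>r+2\<^esub>)\<close>; the product norm is still the Euclidean one.\<close>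

type_synonym 'r gain = "(real ^ 'r) \<times> real \<times> real"

definition \<Theta>_C :: "(real ^ 'r) set \<Rightarrow> real \<Rightarrow> 'r gain set" where
  "\<Theta>_C \<E> T\<^sub>0 = \<E> \<times> {0..1} \<times> {0..T\<^sub>0}"

definition \<Theta>_D :: "(real ^ 'r) set \<Rightarrow> real \<Rightarrow> 'r gain set" where
  "\<Theta>_D \<E> T\<^sub>0 = \<E> \<times> {1} \<times> {0..T\<^sub>0}"

definition zero_gains :: "'r::finite gain set" where
  "zero_gains = {\<theta>. \<exists>i. fst \<theta> $ i = 0}"

definition F_e :: "real \<Rightarrow> real \<Rightarrow> 'r::finite gain \<Rightarrow> 'r gain set" where
  "F_e \<chi>\<^sub>1 \<chi>\<^sub>2 \<theta> = {0} \<times> {0..\<chi>\<^sub>1} \<times> ((\<lambda>c. c - indicator zero_gains \<theta>) ` {0..\<chi>\<^sub>2})"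

definition G_e :: "(real ^ 'r) set \<Rightarrow> 'r gain \<Rightarrow> 'r gain set" where
  "G_e \<E> = (\<lambda>(e, s, \<tau>). (\<E> - {e}) \<times> {0} \<times> {\<tau>})"

definition X_C :: "'p set \<Rightarrow> nat \<Rightarrow> (real \<Rightarrow> 'p \<Rightarrow> real) \<Rightarrow> real \<Rightarrow> ('p \<times> real) set" where
  "X_C M N V \<delta> = {x \<in> M \<times> modes N. synergy_gap N V x \<le> \<delta>}"

definition X_D :: "'p set \<Rightarrow> nat \<Rightarrow> (real \<Rightarrow> 'p \<Rightarrow> real) \<Rightarrow> real \<Rightarrow> ('p \<times> real) set" where
  "X_D M N V \<delta> = {x \<in> M \<times> modes N. synergy_gap N V x \<ge> \<delta>}"

definition G_X :: "nat \<Rightarrow> (real \<Rightarrow> 'p \<Rightarrow> real) \<Rightarrow> 'p \<times> real \<Rightarrow> ('p \<times> real) set" where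
  "G_X N V = (\<lambda>(p, q). {p} \<times> {q'. is_arg_min (\<lambda>q''. V q'' p) (\<lambda>q''. q'' \<in> modes N) q'})"

definition synergistic_system ::
  "'p::euclidean_space set \<Rightarrow> nat \<Rightarrow> (real \<Rightarrow> 'p \<Rightarrow> real) \<Rightarrow> real \<Rightarrow> ('r::finite \<Rightarrow> 'p \<Rightarrow> 'p) \<Rightarrow>
   (real ^ 'r) set \<Rightarrow> real \<Rightarrow> real \<Rightarrow> real \<Rightarrow> ('p \<times> real, 'r gain, 'r) control_system" where
  "synergistic_system M N V \<delta> b \<E> T\<^sub>0 \<chi>\<^sub>1 \<chi>\<^sub>2 =
     (let XC = X_C M N V \<delta>; XD = X_D M N V \<delta>; TC = \<Theta>_C \<E> T\<^sub>0; TD = \<Theta>_D \<E> T\<^sub>0 in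
     \<lparr>x_space = XC \<union> XD,
      gain_space = TC \<union> TD,
      drift = (\<lambda>_. 0),
      ctrl = (\<lambda>i ((p, q), \<theta>). (fst \<theta> $ i) *\<^sub>R (b i p, 0)),
      gain_flow = F_e \<chi>\<^sub>1 \<chi>\<^sub>2,
      c_flow_set = XC \<times> TC,
      c_jump_set = XC \<times> TD \<union> XD \<times> TC \<union> XD \<times> TD,
      c_jump_map = (\<lambda>(x, \<theta>).
        (if x \<in> XD \<and> \<theta> \<in> TD then G_X N V x \<times> G_e \<E> \<theta> else {}) \<union>
        (if x \<in> XC \<and> \<theta> \<in> TD then {x} \<times> G_e \<E> \<theta> else {}) \<union>
        (if x \<in> XD \<and> \<theta> \<in> TC then G_X N V x \<times> {\<theta>} else {}))\<rparr>)"

end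

theory Submission
  imports Defs
begin

text \<open>Write \<open>W (p, q) = V\<^sub>q(p)\<close>. Along flows of the ideal closed loop, with gain \<open>\<gamma> = 1\<close>,
\<open>W\<close> has derivative \<open>- (\<Sum>i. \<theta>\<^sub>i\<^sup>2 * \<langle>\<nabla>V\<^sub>q(p), b\<^sub>i(p)\<rangle>\<^sup>2)\<close>, which is never positive. A jump of the
logic variable lowers \<open>W\<close> by at least \<open>\<delta>\<close>, and a jump of the gains leaves it unchanged. Since
\<open>W\<close> is continuous, proper and positive definite with respect to the target, it lies between two
functions of class K-infinity of the distance to the target; this gives the Lyapunov candidate and
uniform stability.

For attractivity, the decrease of \<open>W\<close> has to be made uniform on \<open>{\<epsilon> \<le> W \<le> c}\<close>. On the part of this
set where flows are allowed, the synergy gap is at most \<open>\<delta>\<close>, so it contains no critical point of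
\<open>V\<^sub>q\<close>. As the fields \<open>b\<^sub>i\<close> span the tangent spaces and the set is compact,
\<open>\<Sum>i. \<langle>\<nabla>V\<^sub>q(p), b\<^sub>i(p)\<rangle>\<^sup>2\<close> is bounded below there by some \<open>\<kappa> > 0\<close>
(\<open>gradient_bounded_below\<close>). This needs the tangent space to be a linear space, which follows
from the flattening charts (\<open>subspace_tangent_space\<close>).

The function \<open>W\<close> alone still does not decrease while some gain vanishes, nor at jumps of the gains.
Both defects are repaired by the two clocks: while a gain vanishes, \<open>\<theta>\<^bsub>r+2\<^esub>\<close> decreases at rate at
least \<open>1 - \<chi>\<^sub>2\<close>, and a jump of the gains resets \<open>\<theta>\<^bsub>r+1\<^esub>\<close> from 1 to 0. Hence, for suitable \<open>A\<close> and
\<open>B\<close>, the function \<open>A * W + B * \<theta>\<^bsub>r+2\<^esub> + \<theta>\<^bsub>r+1\<^esub>\<close> decreases at unit rate in flows and by at least 1 at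
every jump, as long as \<open>\<epsilon> \<le> W \<le> c\<close>. It is nonnegative and at most \<open>A * c + B * T\<^sub>0 + 1\<close> initially, so
this regime cannot last longer than that in the hybrid time \<open>t + j\<close> (\<open>uniform_decay_time\<close>).
A class KL bound is then the supremum of the distances reached by all solutions
(\<open>UGAS_if_stable_and_uniformly_attractive\<close>).

The analytic ingredient is that a function which is absolutely continuous in the \<open>\<epsilon>\<close>-\<open>\<delta>\<close> sense
grows at most at the rate that bounds its derivative almost everywhere
(\<open>abs_continuous_increment_le\<close>); it turns the infinitesimal decrease into a decrease along
solutions (\<open>hybrid_solution_decrease\<close>).\<close>

section \<open>Absolutely continuous functions\<close>

text \<open>The proof is by Cousin's lemma and avoids integration. The exceptional null set is covered by an open
set of small measure. In a division that is fine for a suitable gauge, the cells tagged outside the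
exceptional set obey the slope bound, while those tagged inside it lie in the open cover, so that
their total length is small and absolute continuity makes their contribution small.\<close>

lemma abs_continuous_increment_le:
  fixes f :: "real \<Rightarrow> real"
  assumes ab: "a \<le> b" and ac: "abs_continuous_on {a..b} f"
    and der: "AE t in lebesgue. t \<in> {a<..<b} \<longrightarrow> (\<exists>m\<le>k. (f has_real_derivative m) (at t))"
  shows "f b - f a \<le> k * (b - a)"
proof (rule field_le_epsilon)
  fix \<eta> :: real assume "\<eta> > 0"
  \<comment> \<open>\<open>M\<close> bounds the coefficient of \<open>\<epsilon>\<close> in the final estimate.\<close>
  define M where "M = b - a + \<bar>k\<bar> + 2"
  have M: "M > 0" using ab by (simp add: M_def)
  define \<epsilon> where "\<epsilon> = min 1 (\<eta> / M)"
  have \<epsilon>: "0 < \<epsilon>" "\<epsilon> \<le> 1" "\<epsilon> * M \<le> \<eta>"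
    using \<open>\<eta> > 0\<close> M by (auto simp: \<epsilon>_def min_def field_simps)
  obtain d where "d > 0" and d: "\<And>\<D> K. \<D> division_of K \<Longrightarrow> K \<subseteq> {a..b} \<Longrightarrow>
      (\<Sum>k\<in>\<D>. Sup k - Inf k) < d \<Longrightarrow> (\<Sum>k\<in>\<D>. norm (f (Sup k) - f (Inf k))) < \<epsilon>"
    using ac \<epsilon>(1) unfolding abs_continuous_on_def by metis
  obtain N0 where N0': "N0 \<in> null_sets lebesgue"
    and sub: "{t \<in> space lebesgue. \<not> (t \<in> {a<..<b} \<longrightarrow> (\<exists>m\<le>k. (f has_real_derivative m) (at t)))} \<subseteq> N0"
    using der[unfolded eventually_ae_filter] by blast
  have N0: "\<exists>m\<le>k. (f has_real_derivative m) (at t)" if "t \<notin> N0" "t \<in> {a<..<b}" for t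
  proof (rule ccontr)
    assume "\<not> ?thesis"
    then have "t \<in> N0" using sub that(2) by (intro subsetD[OF sub]) simp
    then show False using that(1) by simp
  qed
  define N where "N = N0 \<union> {a, b}"
  have N: "N \<in> null_sets lebesgue"
    unfolding N_def
  proof (rule null_sets.Un[OF N0'])
    show "{a, b} \<in> null_sets lebesgue"
      by (rule iffD1[OF negligible_iff_null_sets negligible_finite]) simp
  qed
  have "min d \<epsilon> > 0" using \<open>d > 0\<close> \<epsilon>(1) by simp
  then obtain U where U: "open U" "N \<subseteq> U" "U - N \<in> lmeasurable"
      "emeasure lebesgue (U - N) < ennreal (min d \<epsilon>)"
    using sets_lebesgue_outer_open[of N "min d \<epsilon>"] N by blast
  have "U = (U - N) \<union> N" using U by auto
  then have Um: "U \<in> lmeasurable"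
    by (metis N U(3) fmeasurable.Un negligible_iff_measure negligible_iff_null_sets)
  have "measure lebesgue (U - N) = measure lebesgue U"
    using measure_Diff_null_set[of U lebesgue N] N Um by (simp add: fmeasurableD)
  then have Umeas: "measure lebesgue U < min d \<epsilon>"
    using U(3,4) \<open>min d \<epsilon> > 0\<close> by (simp add: emeasure_eq_measure2 ennreal_less_iff)
  have "\<exists>r>0. (t \<in> N \<longrightarrow> ball t r \<subseteq> U) \<and> (t \<in> {a..b} - N \<longrightarrow>
      (\<forall>x y. x \<in> ball t r \<and> y \<in> ball t r \<and> x \<le> t \<and> t \<le> y \<longrightarrow> f y - f x \<le> (k + \<epsilon>) * (y - x)))" for t
  proof (cases "t \<in> {a..b} - N")
    case True
    then have "t \<in> {a<..<b}" "t \<notin> N0" by (auto simp: N_def)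
    then obtain m where "m \<le> k" "(f has_real_derivative m) (at t)" using N0[of t] by blast
    then have "(f has_derivative (\<lambda>h. m * h)) (at t)" by (simp add: has_field_derivative_def)
    then obtain r where "r > 0"
      and r: "\<And>y. norm (y - t) < r \<Longrightarrow> norm (f y - f t - m * (y - t)) \<le> \<epsilon> * norm (y - t)"
      unfolding has_derivative_at_alt using \<epsilon>(1) by metis
    have "f y - f x \<le> (k + \<epsilon>) * (y - x)"
      if "x \<in> ball t r" "y \<in> ball t r" "x \<le> t" "t \<le> y" for x y
    proof -
      have "\<bar>f y - f t - m * (y - t)\<bar> \<le> \<epsilon> * (y - t)" "\<bar>f x - f t - m * (x - t)\<bar> \<le> \<epsilon> * (t - x)"
        using r[of y] r[of x] that by (simp_all add: dist_real_def abs_minus_commute)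
      then have "f y - f x \<le> (m + \<epsilon>) * (y - x)" by (simp add: abs_le_iff algebra_simps)
      also have "\<dots> \<le> (k + \<epsilon>) * (y - x)" using \<open>m \<le> k\<close> that by (intro mult_right_mono) auto
      finally show ?thesis .
    qed
    then show ?thesis using \<open>r > 0\<close> True by blast
  next
    case False
    show ?thesis
    proof (cases "t \<in> N")
      case True
      then obtain r where "r > 0" "ball t r \<subseteq> U" using U openE by blast
      then show ?thesis using True by blast
    qed (use False in \<open>auto intro: exI[of _ 1]\<close>)
  qed
  then obtain r where r: "\<And>t. r t > 0" "\<And>t. t \<in> N \<Longrightarrow> ball t (r t) \<subseteq> U"
    "\<And>t x y. t \<in> {a..b} - N \<Longrightarrow> x \<in> ball t (r t) \<Longrightarrow> y \<in> ball t (r t) \<Longrightarrow> x \<le> t \<Longrightarrow> t \<le> y \<Longrightarrow>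
       f y - f x \<le> (k + \<epsilon>) * (y - x)" by metis
  have "gauge (\<lambda>t. ball t (r t))" using r(1) by (simp add: gauge_def)
  then obtain p where p: "p tagged_division_of {a..b}" and fine: "(\<lambda>t. ball t (r t)) fine p"
    using fine_division_exists_real by blast
  have fin: "finite p" using p by auto
  have cell: "t \<in> K \<and> K \<subseteq> {a..b} \<and> K \<subseteq> ball t (r t) \<and> (\<exists>x y. K = {x..y} \<and> x \<le> t \<and> t \<le> y)"
    if "(t, K) \<in> p" for t K
    using tagged_division_ofD(2-4)[OF p that] fineD[OF fine that] by (auto simp: box_real)
  define B where "B = {(t, K) \<in> p. t \<in> N}"
  define \<D> where "\<D> = snd ` B"
  have "B \<subseteq> p" by (auto simp: B_def)
  have "B tagged_partial_division_of {a..b}"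
    using tagged_partial_division_subset[of p "{a..b}" B] p \<open>B \<subseteq> p\<close>
    by (simp add: tagged_division_of_def)
  then have Bt: "B tagged_division_of \<Union>\<D>"
    unfolding \<D>_def by (rule tagged_partial_division_of_Union_self)
  then have Dd: "\<D> division_of \<Union>\<D>" unfolding \<D>_def by (rule division_of_tagged_division)
  \<comment> \<open>Cells of positive length carry a single tag, and \<open>h\<close> vanishes on the others.\<close>
  have overD: "(\<Sum>(t, K)\<in>B. h K) = (\<Sum>K\<in>\<D>. h K)" if "\<And>x::real. h {x} = 0" for h :: "real set \<Rightarrow> real"
  proof -
    \<comment> \<open>\<open>Sup\<close> and \<open>Inf\<close> of the empty set are unspecified reals, so \<open>h {}\<close> may be nonzero.\<close>
    let ?h = "\<lambda>K. if K = {} then 0 else h K"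
    have "(\<Sum>(t, K)\<in>B. h K) = (\<Sum>(t, K)\<in>B. ?h K)"
      using cell \<open>B \<subseteq> p\<close> by (intro sum.cong) fastforce+
    also have "\<dots> = sum ?h \<D>"
      unfolding \<D>_def
    proof (rule sum.over_tagged_division_lemma[OF Bt])
      fix u v :: real assume "box u v = {}"
      then have "v \<le> u" by simp
      then show "?h (cbox u v) = 0" using that[of u] by (cases "u = v") auto
    qed
    also have "\<dots> = sum h \<D>" using Dd by (intro sum.cong) auto
    finally show ?thesis .
  qed
  have cellD: "K \<subseteq> {a..b} \<and> K \<subseteq> U \<and> (\<exists>x y. K = {x..y} \<and> x \<le> y)" if "K \<in> \<D>" for K
  proof -
    have "\<exists>t. (t, K) \<in> B" using that unfolding \<D>_def by force
    then obtain t where t: "(t, K) \<in> p" "t \<in> N" unfolding B_def by blast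
    obtain x y where K: "K = {x..y}" "x \<le> t" "t \<le> y" using cell[OF t(1)] by blast
    have "K \<subseteq> {a..b}" "K \<subseteq> U" using cell[OF t(1)] r(2)[OF t(2)] by blast+
    moreover have "x \<le> y" using K by simp
    ultimately show ?thesis using K(1) by blast
  qed
  have inU: "\<Union>\<D> \<subseteq> U" using cellD by blast
  have "(\<Sum>K\<in>\<D>. Sup K - Inf K) = (\<Sum>K\<in>\<D>. measure lebesgue K)"
  proof (rule sum.cong[OF refl])
    fix K assume "K \<in> \<D>"
    then obtain x y where "K = {x..y}" "x \<le> y" using cellD by blast
    then show "Sup K - Inf K = measure lebesgue K" by simp
  qed
  also have "\<dots> = measure lebesgue (\<Union>\<D>)" using content_division[OF Dd] by simp
  also have "\<dots> \<le> measure lebesgue U"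
    using inU Um Dd by (intro measure_mono_fmeasurable) (auto intro: fmeasurableD lmeasurable_division)
  finally have len: "(\<Sum>K\<in>\<D>. Sup K - Inf K) < min d \<epsilon>" using Umeas by simp
  have "\<Union>\<D> \<subseteq> {a..b}" using cellD by blast
  then have var: "(\<Sum>K\<in>\<D>. norm (f (Sup K) - f (Inf K))) < \<epsilon>" using d[OF Dd] len by simp
  let ?g = "\<lambda>K. f (Sup K) - f (Inf K) - (k + \<epsilon>) * (Sup K - Inf K)"
  have g: "(\<Sum>(t, K)\<in>p. ?g K) = f b - f a - (k + \<epsilon>) * (b - a)"
  proof -
    let ?h = "\<lambda>x. f x - (k + \<epsilon>) * x"
    have "(\<Sum>(t, K)\<in>p. ?g K) = (\<Sum>(t, K)\<in>p. ?h (Sup K) - ?h (Inf K))"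
      by (intro sum.cong refl) (auto simp: algebra_simps)
    also have "\<dots> = ?h b - ?h a" by (rule additive_tagged_division_1[OF ab p])
    finally show ?thesis by (simp add: algebra_simps)
  qed
  have "(\<Sum>(t, K)\<in>p - B. ?g K) \<le> 0"
  proof (rule sum_nonpos)
    fix q assume "q \<in> p - B"
    then obtain t K where q: "q = (t, K)" "(t, K) \<in> p" "t \<notin> N" by (auto simp: B_def)
    obtain x y where K: "K = {x..y}" "x \<le> t" "t \<le> y" using cell[OF q(2)] by blast
    have "K \<subseteq> ball t (r t)" "t \<in> {a..b} - N" using cell[OF q(2)] q(3) by blast+
    moreover have "x \<in> K" "y \<in> K" using K by auto
    ultimately have "f y - f x \<le> (k + \<epsilon>) * (y - x)" using r(3) K by blast
    moreover have "Sup K = y" "Inf K = x" using K by auto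
    ultimately have "?g K \<le> 0" by simp
    then show "(case q of (t, K) \<Rightarrow> ?g K) \<le> 0" using q(1) by simp
  qed
  moreover have "(\<Sum>(t, K)\<in>B. ?g K) \<le> \<epsilon> + (\<bar>k\<bar> + 1) * \<epsilon>"
  proof -
    have "(\<Sum>(t, K)\<in>B. ?g K) = (\<Sum>K\<in>\<D>. ?g K)" by (rule overD) simp
    also have "\<dots> \<le> (\<Sum>K\<in>\<D>. norm (f (Sup K) - f (Inf K)) + (\<bar>k\<bar> + 1) * (Sup K - Inf K))"
    proof (rule sum_mono)
      fix K assume "K \<in> \<D>"
      then obtain x y where K: "K = {x..y}" "x \<le> y" using cellD by blast
      have "- (k + \<epsilon>) * (y - x) \<le> (\<bar>k\<bar> + 1) * (y - x)"
        using K \<epsilon> by (intro mult_right_mono) auto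
      then show "?g K \<le> norm (f (Sup K) - f (Inf K)) + (\<bar>k\<bar> + 1) * (Sup K - Inf K)"
        using K by (simp add: algebra_simps)
    qed
    also have "\<dots> \<le> \<epsilon> + (\<bar>k\<bar> + 1) * \<epsilon>"
      unfolding sum.distrib sum_distrib_left[symmetric]
      using var len by (intro add_mono mult_left_mono) auto
    finally show ?thesis .
  qed
  moreover have "(\<Sum>(t, K)\<in>p. ?g K) = (\<Sum>(t, K)\<in>p - B. ?g K) + (\<Sum>(t, K)\<in>B. ?g K)"
    using sum.subset_diff[OF \<open>B \<subseteq> p\<close> fin] by simp
  ultimately have "f b - f a - (k + \<epsilon>) * (b - a) \<le> \<epsilon> + (\<bar>k\<bar> + 1) * \<epsilon>" using g by linarith
  then have "f b - f a \<le> k * (b - a) + \<epsilon> * M" by (simp add: M_def algebra_simps)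
  then show "f b - f a \<le> k * (b - a) + \<eta>" using \<epsilon>(3) by linarith
qed

lemma abs_continuous_on_lipschitz_compose:
  assumes ac: "abs_continuous_on S c" and lip: "L-lipschitz_on (c ` S) W"
  shows "abs_continuous_on S (\<lambda>t. W (c t))"
  unfolding abs_continuous_on_def
proof (intro allI impI)
  fix \<epsilon> :: real assume "\<epsilon> > 0"
  have L: "L \<ge> 0" using lip by (rule lipschitz_on_nonneg)
  then have "\<epsilon> / (L + 1) > 0" using \<open>\<epsilon> > 0\<close> by simp
  then obtain d where "d > 0" and d: "\<And>\<D> K. \<D> division_of K \<and> K \<subseteq> S \<and> (\<Sum>k\<in>\<D>. Sup k - Inf k) < d \<Longrightarrow>
      (\<Sum>k\<in>\<D>. norm (c (Sup k) - c (Inf k))) < \<epsilon> / (L + 1)"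
    using ac unfolding abs_continuous_on_def by metis
  have "(\<Sum>k\<in>\<D>. norm (W (c (Sup k)) - W (c (Inf k)))) < \<epsilon>"
    if D: "\<D> division_of K \<and> K \<subseteq> S \<and> (\<Sum>k\<in>\<D>. Sup k - Inf k) < d" for \<D> K
  proof -
    have "(\<Sum>k\<in>\<D>. norm (W (c (Sup k)) - W (c (Inf k)))) \<le> (\<Sum>k\<in>\<D>. L * norm (c (Sup k) - c (Inf k)))"
    proof (rule sum_mono)
      fix k assume "k \<in> \<D>"
      with D have "k \<subseteq> S" "k \<noteq> {}" "\<exists>x y. k = cbox x y"
        using division_ofD[of \<D> K] by blast+
      then obtain x y where "k = {x..y}" "x \<le> y" by (auto simp: box_real)
      then have "Sup k \<in> S" "Inf k \<in> S" using \<open>k \<subseteq> S\<close> by auto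
      then show "norm (W (c (Sup k)) - W (c (Inf k))) \<le> L * norm (c (Sup k) - c (Inf k))"
        using lipschitz_on_normD[OF lip] by blast
    qed
    also have "\<dots> = L * (\<Sum>k\<in>\<D>. norm (c (Sup k) - c (Inf k)))" by (simp add: sum_distrib_left)
    also have "\<dots> \<le> L * (\<epsilon> / (L + 1))" using d[OF D] L by (intro mult_left_mono) auto
    also have "\<dots> < \<epsilon>" using L \<open>\<epsilon> > 0\<close> by (simp add: field_simps)
    finally show ?thesis .
  qed
  then show "\<exists>d>0. \<forall>\<D> K. \<D> division_of K \<and> K \<subseteq> S \<and> (\<Sum>k\<in>\<D>. Sup k - Inf k) < d \<longrightarrow>
      (\<Sum>k\<in>\<D>. norm (W (c (Sup k)) - W (c (Inf k)))) < \<epsilon>"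
    using \<open>d > 0\<close> by blast
qed

lemma abs_continuous_on_imp_continuous_on:
  assumes "abs_continuous_on {a..b} c"
  shows "continuous_on {a..b} c"
proof (unfold continuous_on_iff, intro ballI allI impI)
  fix x \<epsilon> :: real assume x: "x \<in> {a..b}" and "\<epsilon> > 0"
  then obtain d where "d > 0" and d: "\<And>\<D> K. \<D> division_of K \<and> K \<subseteq> {a..b} \<and> (\<Sum>k\<in>\<D>. Sup k - Inf k) < d \<Longrightarrow>
      (\<Sum>k\<in>\<D>. norm (c (Sup k) - c (Inf k))) < \<epsilon>"
    using assms unfolding abs_continuous_on_def by metis
  have *: "norm (c v - c u) < \<epsilon>" if "u \<in> {a..b}" "v \<in> {a..b}" "u \<le> v" "v - u < d" for u v
    using d[of "{{u..v}}" "{u..v}"] that division_of_self[of u v] by (auto simp: box_real)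
  show "\<exists>d>0. \<forall>y\<in>{a..b}. dist y x < d \<longrightarrow> dist (c y) (c x) < \<epsilon>"
  proof (intro exI[of _ d] conjI ballI impI)
    fix y assume "y \<in> {a..b}" "dist y x < d"
    then show "dist (c y) (c x) < \<epsilon>"
      using *[of x y] *[of y x] x by (cases "x \<le> y") (auto simp: dist_norm norm_minus_commute)
  qed (use \<open>d > 0\<close> in auto)
qed

section \<open>Functions of class C1 along curves\<close>

lemma C1_open_derivative:
  assumes "C1_open U g" "x \<in> U"
  shows "\<exists>g'. (\<forall>y\<in>U. (g has_derivative blinfun_apply (g' y)) (at y)) \<and> continuous (at x) g'"
proof -
  obtain g' where U: "open U" and d: "\<forall>y\<in>U. (g has_derivative blinfun_apply (g' y)) (at y)"
    and l: "\<forall>y\<in>U. \<exists>e>0. \<exists>L. L-lipschitz_on (ball y e \<inter> U) g'"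
    using assms(1) unfolding C1_open_def by blast
  obtain e L where "e > 0" "L-lipschitz_on (ball x e \<inter> U) g'" using l assms(2) by blast
  then have "continuous_on (ball x e \<inter> U) g'" by (auto intro: lipschitz_on_continuous_on)
  moreover have "open (ball x e \<inter> U)" "x \<in> ball x e \<inter> U" using U assms(2) \<open>e > 0\<close> by auto
  ultimately have "continuous (at x) g'" using continuous_on_eq_continuous_at by blast
  with d show ?thesis by blast
qed

lemma C1_fun_on_locally_lipschitz:
  assumes "C1_fun_on X W" "x \<in> X"
  shows "\<exists>e>0. \<exists>L. L-lipschitz_on (cball x e \<inter> X) W"
proof -
  obtain U g where "local_C1_extension X W x U g" using assms unfolding C1_fun_on_def by blast
  then have ext: "x \<in> U" "C1_open U g" "\<And>y. y \<in> U \<inter> X \<Longrightarrow> g y = W y"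
    by (simp_all add: local_C1_extension_def)
  obtain g' where d: "\<forall>y\<in>U. (g has_derivative blinfun_apply (g' y)) (at y)"
    and c: "continuous (at x) g'" using C1_open_derivative[OF ext(2,1)] by blast
  have "open U" using ext(2) by (simp add: C1_open_def)
  then obtain e1 where e1: "e1 > 0" "ball x e1 \<subseteq> U" using ext(1) openE by blast
  obtain e2 where e2: "e2 > 0" "\<And>y. dist y x < e2 \<Longrightarrow> dist (g' y) (g' x) < 1"
    using c unfolding continuous_at_eps_delta by (meson zero_less_one)
  define e where "e = min e1 e2 / 2"
  have e: "e > 0" "e < e1" "e < e2" using e1(1) e2(1) by (auto simp: e_def)
  have "(norm (g' x) + 1)-lipschitz_on (cball x e \<inter> X) W"
  proof (rule lipschitz_onI)
    fix y z assume yz: "y \<in> cball x e \<inter> X" "z \<in> cball x e \<inter> X"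
    have sub: "cball x e \<subseteq> U" using e e1(2) by (auto simp: subset_iff)
    have "norm (g y - g z) \<le> (norm (g' x) + 1) * norm (y - z)"
    proof (rule differentiable_bound[OF convex_cball])
      fix w assume w: "w \<in> cball x e"
      show "(g has_derivative blinfun_apply (g' w)) (at w within cball x e)"
        using d w sub has_derivative_at_withinI by blast
      have "dist (g' w) (g' x) < 1" using w e by (intro e2(2)) (auto simp: dist_commute)
      then have "norm (g' w) \<le> norm (g' x) + 1"
        using norm_triangle_ineq2[of "g' w" "g' x"] by (simp add: dist_norm)
      then show "onorm (blinfun_apply (g' w)) \<le> norm (g' x) + 1" by (simp add: norm_blinfun.rep_eq)
    qed (use yz in auto)
    moreover have "g y = W y" "g z = W z" using yz sub ext(3) by auto
    ultimately show "dist (W y) (W z) \<le> (norm (g' x) + 1) * dist y z" by (simp add: dist_norm)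
  qed simp
  then show ?thesis using e(1) by blast
qed

lemma C1_fun_on_continuous_on:
  assumes "C1_fun_on X W"
  shows "continuous_on X W"
proof (unfold continuous_on_eq_continuous_within, rule ballI)
  fix x assume "x \<in> X"
  then obtain e L where "e > 0" "L-lipschitz_on (cball x e \<inter> X) W"
    using C1_fun_on_locally_lipschitz[OF assms] by blast
  then have "continuous_on (cball x e \<inter> X) W" by (blast intro: lipschitz_on_continuous_on)
  then have "continuous (at x within cball x e \<inter> X) W"
    using \<open>x \<in> X\<close> \<open>e > 0\<close> by (auto simp: continuous_on_eq_continuous_within)
  moreover have "at x within cball x e \<inter> X = at x within X"
    by (rule at_within_nhd[of x "ball x e"]) (use \<open>e > 0\<close> in auto)
  ultimately show "continuous (at x within X) W" by (simp add: continuous_within)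
qed

lemma C1_fun_on_lipschitz_on_compact:
  assumes "C1_fun_on X W" "compact K" "K \<subseteq> X"
  shows "\<exists>L. L-lipschitz_on K W"
proof -
  have "local_lipschitz {0::real} K (\<lambda>_. W)"
  proof (rule local_lipschitzI)
    fix x assume "x \<in> K"
    then obtain e L where "e > 0" "L-lipschitz_on (cball x e \<inter> X) W"
      using C1_fun_on_locally_lipschitz assms by blast
    then have "L-lipschitz_on (cball x e \<inter> K) W"
      using assms(3) by (meson Int_mono lipschitz_on_subset order_refl)
    then show "\<exists>u>0. \<exists>L. \<forall>t\<in>cball t u \<inter> {0::real}. L-lipschitz_on (cball x u \<inter> K) W" for t
      using \<open>e > 0\<close> by blast
  qed
  then show ?thesis
    by (rule local_lipschitz_compact_implies_lipschitz[OF _ assms(2)]) auto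
qed

text \<open>The gradient is chosen together with an extension of which it is the gradient. A general local
extension only shares its derivative along curves that stay in the set.\<close>

lemma C1_fun_on_nablaE:
  fixes W :: "'a::euclidean_space \<Rightarrow> real"
  assumes "C1_fun_on X W" "x \<in> X"
  obtains U g where "local_C1_extension X W x U g"
    "(g has_derivative (\<lambda>h. nabla X W x \<bullet> h)) (at x)"
proof -
  obtain U g where ext: "local_C1_extension X W x U g"
    using assms unfolding C1_fun_on_def by blast
  then obtain g' where "(g has_derivative blinfun_apply (g' x)) (at x)"
    unfolding local_C1_extension_def using C1_open_derivative by blast
  then obtain D where D: "(g has_derivative D) (at x)" by blast
  then have "linear D" using has_derivative_linear by blast
  then have "adjoint D 1 \<bullet> h = D h" for h
    using adjoint_works[of D h 1] by (simp add: inner_commute)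
  with D have "(g has_derivative (\<lambda>h. adjoint D 1 \<bullet> h)) (at x)" by simp
  with ext have "\<exists>v U g. local_C1_extension X W x U g \<and> (g has_derivative (\<lambda>h. v \<bullet> h)) (at x)"
    by blast
  then have "\<exists>U g. local_C1_extension X W x U g \<and> (g has_derivative (\<lambda>h. nabla X W x \<bullet> h)) (at x)"
    unfolding nabla_def by (rule someI_ex)
  then show ?thesis using that by metis
qed

text \<open>The values of \<open>W\<close> along a curve in \<open>X\<close> are those of any extension, so the chain rule applies although
\<open>W\<close> itself need not be differentiable in the ambient space.\<close>

lemma C1_extension_along_curve:
  fixes W :: "'a::euclidean_space \<Rightarrow> real"
  assumes ext: "local_C1_extension X W (c t) U g" and g: "(g has_derivative D) (at (c t))"
    and c: "(c has_vector_derivative v) (at t)" and X: "\<forall>\<^sub>F s in nhds t. c s \<in> X"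
  shows "((\<lambda>s. W (c s)) has_real_derivative D v) (at t)"
proof -
  have "(g has_derivative D) (at (c t) within c ` UNIV)"
    using g by (rule has_derivative_at_withinI)
  then have "((\<lambda>s. g (c s)) has_derivative (\<lambda>h. D (h *\<^sub>R v))) (at t)"
    using diff_chain_at[of c "\<lambda>h. h *\<^sub>R v" t g D] c g
    by (simp add: has_vector_derivative_def o_def)
  moreover have "D (h *\<^sub>R v) = D v * h" for h
    using linear_scale[OF has_derivative_linear[OF g], of h v] by simp
  ultimately have gc: "((\<lambda>s. g (c s)) has_real_derivative D v) (at t)"
    by (simp add: has_field_derivative_def)
  have "isCont c t" using c has_vector_derivative_continuous by blast
  moreover have "open U" "c t \<in> U"
    using ext by (auto simp: local_C1_extension_def C1_open_def)
  ultimately have "\<forall>\<^sub>F s in nhds t. c s \<in> U"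
    by (simp add: continuous_at topological_tendstoD eventually_nhds_conv_at isCont_def)
  with X have "\<forall>\<^sub>F s in nhds t. g (c s) = W (c s)"
    by eventually_elim (use ext in \<open>auto simp: local_C1_extension_def\<close>)
  then have "((\<lambda>s. g (c s)) has_real_derivative D v) (at t) \<longleftrightarrow>
      ((\<lambda>s. W (c s)) has_real_derivative D v) (at t)"
    by (intro DERIV_cong_ev) auto
  with gc show ?thesis by simp
qed

lemma nabla_along_curve:
  fixes W :: "'a::euclidean_space \<Rightarrow> real"
  assumes "C1_fun_on X W" and c: "(c has_vector_derivative v) (at t)"
    and X: "\<forall>\<^sub>F s in nhds t. c s \<in> X"
  shows "((\<lambda>s. W (c s)) has_real_derivative nabla X W (c t) \<bullet> v) (at t)"
proof -
  have "c t \<in> X" using eventually_nhds_x_imp_x[OF X] .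
  then obtain U g where "local_C1_extension X W (c t) U g"
    "(g has_derivative (\<lambda>h. nabla X W (c t) \<bullet> h)) (at (c t))"
    using C1_fun_on_nablaE[OF assms(1)] by blast
  from C1_extension_along_curve[OF this c X] show ?thesis .
qed

lemma tangent_spaceE:
  assumes "v \<in> tangent_space M p"
  obtains c where "(c has_vector_derivative v) (at 0)" "c 0 = p" "\<forall>\<^sub>F s in nhds 0. c s \<in> M"
proof -
  obtain c e where "0 < e" "c ` {-e<..<e} \<subseteq> M" "c 0 = p" "(c has_vector_derivative v) (at 0)"
    using assms unfolding tangent_space_def by blast
  moreover have "\<forall>\<^sub>F s in nhds 0. c s \<in> M"
    unfolding eventually_nhds using \<open>0 < e\<close> \<open>c ` {-e<..<e} \<subseteq> M\<close>
    by (intro exI[of _ "{-e<..<e}"]) auto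
  ultimately show ?thesis using that by blast
qed

lemma nabla_inner_tangent:
  fixes W :: "'a::euclidean_space \<Rightarrow> real"
  assumes "C1_fun_on M W" "p \<in> M" "v \<in> tangent_space M p"
    and "local_C1_extension M W p U g" "(g has_derivative D) (at p)"
  shows "nabla M W p \<bullet> v = D v"
proof -
  obtain c where c: "(c has_vector_derivative v) (at 0)" "c 0 = p" "\<forall>\<^sub>F s in nhds 0. c s \<in> M"
    using assms(3) tangent_spaceE by blast
  have "((\<lambda>s. W (c s)) has_real_derivative nabla M W p \<bullet> v) (at 0)"
    using nabla_along_curve[OF assms(1) c(1,3)] c(2) by simp
  moreover have "((\<lambda>s. W (c s)) has_real_derivative D v) (at 0)"
    using C1_extension_along_curve[of M W c 0 U g D v] c assms(4,5) by simp
  ultimately show ?thesis by (rule DERIV_unique)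
qed

text \<open>The gradient itself may jump, as it depends on an arbitrary choice of extension at every point. Its
product with a tangent field does not depend on the choice, so near a point it can be computed
from one extension, whose derivative is continuous.\<close>

lemma continuous_on_nabla_inner:
  fixes W :: "'a::euclidean_space \<Rightarrow> real"
  assumes W: "C1_fun_on M W" and b: "continuous_on M b"
    and tan: "\<And>p. p \<in> M \<Longrightarrow> b p \<in> tangent_space M p"
  shows "continuous_on M (\<lambda>p. nabla M W p \<bullet> b p)"
proof (unfold continuous_on_eq_continuous_within, rule ballI)
  fix p assume p: "p \<in> M"
  obtain U g where ext: "local_C1_extension M W p U g"
    using W p unfolding C1_fun_on_def by blast
  then have U: "open U" "p \<in> U" "C1_open U g" by (auto simp: local_C1_extension_def C1_open_def)
  obtain g' where g': "\<forall>y\<in>U. (g has_derivative blinfun_apply (g' y)) (at y)"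
    and c: "continuous (at p) g'" using C1_open_derivative[OF U(3,2)] by blast
  have lim: "continuous (at p within M) (\<lambda>y. blinfun_apply (g' y) (b y))"
    using c b p by (intro bounded_bilinear.continuous[OF bounded_bilinear_blinfun_apply])
      (auto simp: continuous_on_eq_continuous_within continuous_at_imp_continuous_at_within)
  have eq: "blinfun_apply (g' y) (b y) = nabla M W y \<bullet> b y" if "y \<in> M \<inter> U" for y
  proof (rule nabla_inner_tangent[OF W, symmetric])
    show "local_C1_extension M W y U g" using ext that by (auto simp: local_C1_extension_def)
  qed (use that g' tan in auto)
  have "\<forall>\<^sub>F y in at p within M. blinfun_apply (g' y) (b y) = nabla M W y \<bullet> b y"
    unfolding eventually_at_topological using U(1,2) eq by (intro exI[of _ U]) auto
  with lim[unfolded continuous_within]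
  have "((\<lambda>y. nabla M W y \<bullet> b y) \<longlongrightarrow> blinfun_apply (g' p) (b p)) (at p within M)"
    by (rule Lim_transform_eventually)
  then show "continuous (at p within M) (\<lambda>p. nabla M W p \<bullet> b p)"
    unfolding continuous_within using eq[of p] p U(2) by simp
qed

text \<open>Distinct modes have distance at least 1, so near \<open>(p, q)\<close> an extension of \<open>V q\<close> that ignores the
second coordinate extends the whole family.\<close>

lemma C1_fun_on_modes_product:
  fixes V :: "real \<Rightarrow> 'p::euclidean_space \<Rightarrow> real"
  assumes V: "\<And>q. q \<in> modes N \<Longrightarrow> C1_fun_on M (V q)"
  shows "C1_fun_on (M \<times> modes N) (\<lambda>(p, q). V q p)"
  unfolding C1_fun_on_def
proof safe
  fix p q assume p: "p \<in> M" and q: "q \<in> modes N"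
  obtain U g where ext: "local_C1_extension M (V q) p U g"
    using V[OF q] p unfolding C1_fun_on_def by blast
  then obtain g' where U: "open U" "p \<in> U" "\<forall>y\<in>U \<inter> M. g y = V q y"
    and d: "\<forall>y\<in>U. (g has_derivative blinfun_apply (g' y)) (at y)"
    and l: "\<forall>y\<in>U. \<exists>e>0. \<exists>L. L-lipschitz_on (ball y e \<inter> U) g'"
    unfolding local_C1_extension_def C1_open_def by blast
  let ?U = "U \<times> ball q 1" and ?g = "\<lambda>x. g (fst x)"
  define F :: "('p \<times> real) \<Rightarrow>\<^sub>L 'p" where "F = Blinfun fst"
  have F: "blinfun_apply F = fst" by (simp add: F_def bounded_linear_Blinfun_apply bounded_linear_fst)
  have "\<forall>x\<in>?U. (?g has_derivative blinfun_apply (g' (fst x) o\<^sub>L F)) (at x)"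
  proof
    fix x assume "x \<in> ?U"
    then have "(g has_derivative blinfun_apply (g' (fst x))) (at (fst x))" using d by auto
    from diff_chain_at[OF has_derivative_fst[OF has_derivative_ident] this]
    show "(?g has_derivative blinfun_apply (g' (fst x) o\<^sub>L F)) (at x)"
      by (simp add: o_def F blinfun_compose.rep_eq)
  qed
  moreover have "\<forall>x\<in>?U. \<exists>e>0. \<exists>L. L-lipschitz_on (ball x e \<inter> ?U) (\<lambda>x. g' (fst x) o\<^sub>L F)"
  proof
    fix x assume "x \<in> ?U"
    then obtain e L where e: "e > 0" and L: "L-lipschitz_on (ball (fst x) e \<inter> U) g'" using l by auto
    have "(norm F * L)-lipschitz_on (ball x e \<inter> ?U) (\<lambda>x. g' (fst x) o\<^sub>L F)"
    proof (rule lipschitz_onI)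
      fix y z assume yz: "y \<in> ball x e \<inter> ?U" "z \<in> ball x e \<inter> ?U"
      have "dist (g' (fst y) o\<^sub>L F) (g' (fst z) o\<^sub>L F) = norm ((g' (fst y) - g' (fst z)) o\<^sub>L F)"
        by (simp add: dist_norm bounded_bilinear.diff_left[OF bounded_bilinear_blinfun_compose])
      also have "\<dots> \<le> norm (g' (fst y) - g' (fst z)) * norm F" by (rule norm_blinfun_compose)
      also have "\<dots> \<le> (L * dist (fst y) (fst z)) * norm F"
      proof (rule mult_right_mono)
        have "fst y \<in> ball (fst x) e \<inter> U" "fst z \<in> ball (fst x) e \<inter> U"
          using yz dist_fst_le[of x] by (auto intro: le_less_trans)
        then show "norm (g' (fst y) - g' (fst z)) \<le> L * dist (fst y) (fst z)"
          using lipschitz_onD[OF L] by (simp add: dist_norm)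
      qed simp
      also have "\<dots> \<le> (L * dist y z) * norm F"
        using lipschitz_on_nonneg[OF L] by (intro mult_right_mono mult_left_mono dist_fst_le) auto
      finally show "dist (g' (fst y) o\<^sub>L F) (g' (fst z) o\<^sub>L F) \<le> norm F * L * dist y z"
        by (simp add: mult_ac)
    qed (use lipschitz_on_nonneg[OF L] in simp)
    with e show "\<exists>e>0. \<exists>L. L-lipschitz_on (ball x e \<inter> ?U) (\<lambda>x. g' (fst x) o\<^sub>L F)" by blast
  qed
  moreover have "open ?U" using U(1) by (intro open_Times) auto
  ultimately have "C1_open ?U ?g"
    unfolding C1_open_def by (intro conjI exI[of _ "\<lambda>x. g' (fst x) o\<^sub>L F"])
  moreover have "?g y = (case y of (p, q) \<Rightarrow> V q p)" if y: "y \<in> ?U \<inter> (M \<times> modes N)" for y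
  proof -
    obtain p' q' where y': "y = (p', q')" by (cases y)
    have "q' \<in> modes N" "dist q q' < 1" using y y' by auto
    then have "q' = q" using q by (auto simp: modes_def dist_real_def)
    then show ?thesis using U(3) y y' by simp
  qed
  ultimately show "\<exists>U g. local_C1_extension (M \<times> modes N) (\<lambda>(p, q). V q p) (p, q) U g"
    unfolding local_C1_extension_def using U(2) by (intro exI[of _ ?U] exI[of _ ?g]) simp
qed

text \<open>Both sides are the derivative of \<open>W\<close> along one curve, moved in the first coordinate only.\<close>

lemma nabla_product_eq:
  fixes W :: "'p::euclidean_space \<times> 'q::euclidean_space \<Rightarrow> real"
  assumes W: "C1_fun_on (M \<times> Q) W" and Wq: "C1_fun_on M (\<lambda>p. W (p, q))"
    and q: "q \<in> Q" and v: "v \<in> tangent_space M p"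
  shows "nabla (M \<times> Q) W (p, q) \<bullet> (v, 0) = nabla M (\<lambda>p. W (p, q)) p \<bullet> v"
proof -
  obtain c where c: "(c has_vector_derivative v) (at 0)" "c 0 = p" "\<forall>\<^sub>F s in nhds 0. c s \<in> M"
    using v tangent_spaceE by blast
  have "((\<lambda>s. (c s, q)) has_vector_derivative (v, 0)) (at 0)"
    by (intro has_vector_derivative_Pair c(1) has_vector_derivative_const)
  moreover have "\<forall>\<^sub>F s in nhds 0. (c s, q) \<in> M \<times> Q"
    using c(3) by eventually_elim (use q in simp)
  ultimately have "((\<lambda>s. W (c s, q)) has_real_derivative nabla (M \<times> Q) W (p, q) \<bullet> (v, 0)) (at 0)"
    using nabla_along_curve[OF W, of "\<lambda>s. (c s, q)" "(v, 0)" 0] c(2) by simp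
  moreover have "((\<lambda>s. W (c s, q)) has_real_derivative nabla M (\<lambda>p. W (p, q)) p \<bullet> v) (at 0)"
    using nabla_along_curve[OF Wq c(1,3)] c(2) by simp
  ultimately show ?thesis by (rule DERIV_unique)
qed

section \<open>Tangent spaces and critical points\<close>

text \<open>The velocity \<open>D w\<close> is realised by the image of the straight line \<open>\<phi> p + t *\<^sub>R w\<close> under the inverse
chart \<open>\<psi>\<close>.\<close>

lemma embedded_submanifold_chart_tangent:
  assumes U: "open U" "p \<in> U" "open W" "homeomorphism U W \<phi> \<psi>" "smooth_on W \<psi>"
    and S: "subspace S" "\<phi> ` (U \<inter> M) = W \<inter> S" and p: "p \<in> M"
    and D: "(\<psi> has_derivative D) (at (\<phi> p))" and w: "w \<in> S"
  shows "D w \<in> tangent_space M p"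
proof -
  have phi: "\<phi> p \<in> W" "\<phi> p \<in> S" using S(2) U(2) p by auto
  obtain r where r: "r > 0" "ball (\<phi> p) r \<subseteq> W" using U(3) phi(1) openE by blast
  define e where "e = r / (norm w + 1)"
  have e: "e > 0" using r by (simp add: e_def add_nonneg_pos)
  have line: "\<phi> p + t *\<^sub>R w \<in> W \<inter> S" if "t \<in> {-e<..<e}" for t
  proof
    have "norm (t *\<^sub>R w) \<le> e * norm w" using that by (auto intro!: mult_right_mono)
    also have "\<dots> < e * (norm w + 1)" using e by simp
    also have "\<dots> = r" using add_nonneg_pos[OF norm_ge_zero[of w] zero_less_one] by (simp add: e_def)
    finally have "\<phi> p + t *\<^sub>R w \<in> ball (\<phi> p) r" by (simp add: dist_norm)
    then show "\<phi> p + t *\<^sub>R w \<in> W" using r(2) by blast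
    show "\<phi> p + t *\<^sub>R w \<in> S" using phi(2) w S(1) by (simp add: subspace_add subspace_scale)
  qed
  define c where "c = (\<lambda>t. \<psi> (\<phi> p + t *\<^sub>R w))"
  have hd: "higher_differentiable_on W \<psi> (Suc 0)"
    using U(5) unfolding smooth_on_def by (rule spec)
  have dc: "(c has_vector_derivative frechet_derivative \<psi> (at (\<phi> p + t *\<^sub>R w)) w) (at t)"
    if "t \<in> {-e<..<e}" for t
  proof -
    have "\<psi> differentiable (at (\<phi> p + t *\<^sub>R w))" using hd line[OF that] by simp
    then have "(\<psi> has_derivative frechet_derivative \<psi> (at (\<phi> p + t *\<^sub>R w))) (at (\<phi> p + t *\<^sub>R w))"
      unfolding frechet_derivative_works .
    moreover have "((\<lambda>t. \<phi> p + t *\<^sub>R w) has_derivative (\<lambda>h. h *\<^sub>R w)) (at t)"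
      by (auto intro!: derivative_eq_intros)
    ultimately have "(c has_derivative
        (\<lambda>h. frechet_derivative \<psi> (at (\<phi> p + t *\<^sub>R w)) (h *\<^sub>R w))) (at t)"
      unfolding c_def using diff_chain_at by (fastforce simp: o_def)
    then show ?thesis
      unfolding has_vector_derivative_def
      using linear_scale[OF linear_frechet_derivative[OF \<open>\<psi> differentiable _\<close>]] by simp
  qed
  have "continuous_on W (\<lambda>x. frechet_derivative \<psi> (at x) w)" using hd by simp
  moreover have "continuous_on {-e<..<e} (\<lambda>t. \<phi> p + t *\<^sub>R w)" by (intro continuous_intros)
  moreover have "(\<lambda>t. \<phi> p + t *\<^sub>R w) ` {-e<..<e} \<subseteq> W" using line by blast
  ultimately have "continuous_on {-e<..<e} (\<lambda>t. frechet_derivative \<psi> (at (\<phi> p + t *\<^sub>R w)) w)"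
    by (rule continuous_on_compose2)
  then have "c C1_differentiable_on {-e<..<e}"
    unfolding C1_differentiable_on_def
    by (intro exI[of _ "\<lambda>t. frechet_derivative \<psi> (at (\<phi> p + t *\<^sub>R w)) w"]) (use dc in simp)
  moreover have "c ` {-e<..<e} \<subseteq> M"
  proof
    fix y assume "y \<in> c ` {-e<..<e}"
    then obtain t where t: "t \<in> {-e<..<e}" "y = c t" by blast
    have "\<phi> p + t *\<^sub>R w \<in> \<phi> ` (U \<inter> M)" using line[OF t(1)] S(2) by simp
    then obtain m where m: "m \<in> U \<inter> M" "\<phi> p + t *\<^sub>R w = \<phi> m" by blast
    have "\<psi> (\<phi> m) = m" using homeomorphism_apply1[OF U(4)] m(1) by blast
    then show "y \<in> M" using t(2) m by (simp add: c_def)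
  qed
  moreover have "c 0 = p" using U(2,4) by (simp add: c_def homeomorphism_apply1)
  moreover have "(c has_vector_derivative D w) (at 0)"
    using dc[of 0] e frechet_derivative_at[OF D] by simp
  ultimately show ?thesis
    using e unfolding tangent_space_def mem_Collect_eq by (intro exI[of _ c] exI[of _ e]) simp
qed

text \<open>The tangent space is the image of the model space \<open>S\<close> under the derivative of the inverse chart.
For the inclusion that does not come from lifting lines, a curve in \<open>M\<close> is mapped into \<open>S\<close> by
the chart; its velocity there is orthogonal to everything orthogonal to \<open>S\<close>.\<close>

lemma subspace_tangent_space:
  fixes M :: "'a::euclidean_space set"
  assumes M: "embedded_submanifold k M" and p: "p \<in> M"
  shows "subspace (tangent_space M p)"
proof -
  obtain U \<phi> \<psi> and W S :: "'a set" where U: "open U" "p \<in> U" "open W" "homeomorphism U W \<phi> \<psi>"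
    and sm: "smooth_on U \<phi>" "smooth_on W \<psi>"
    and S: "subspace S" "\<phi> ` (U \<inter> M) = W \<inter> S"
    using M p unfolding embedded_submanifold_def by metis
  have phi: "\<phi> p \<in> W" using U(2,4) by (auto simp: homeomorphism_def)
  have "higher_differentiable_on U \<phi> (Suc 0)" "higher_differentiable_on W \<psi> (Suc 0)"
    using sm unfolding smooth_on_def by (simp_all only:)
  then have "\<phi> differentiable (at p)" "\<psi> differentiable (at (\<phi> p))"
    using U(2) phi by simp_all
  then obtain A D where A: "(\<phi> has_derivative A) (at p)" and D: "(\<psi> has_derivative D) (at (\<phi> p))"
    unfolding differentiable_def by blast
  note lin = has_derivative_linear[OF A] has_derivative_linear[OF D]
  have DA: "D (A v) = v" for v
  proof -
    have "((\<lambda>x. \<psi> (\<phi> x)) has_derivative (\<lambda>h. D (A h))) (at p)"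
      using diff_chain_at[OF A D] by (simp add: o_def)
    moreover have "((\<lambda>x. \<psi> (\<phi> x)) has_derivative (\<lambda>h. h)) (at p)"
      by (rule has_derivative_transform_within_open[OF has_derivative_ident U(1,2)])
        (use U(4) in \<open>auto simp: homeomorphism_apply1\<close>)
    ultimately show ?thesis using has_derivative_unique by metis
  qed
  have AS: "A v \<in> S" if v: "v \<in> tangent_space M p" for v
  proof -
    obtain c where c: "(c has_vector_derivative v) (at 0)" "c 0 = p" "\<forall>\<^sub>F s in nhds 0. c s \<in> M"
      using v tangent_spaceE by blast
    have "isCont c 0" using c(1) has_vector_derivative_continuous by blast
    then have "\<forall>\<^sub>F s in nhds 0. c s \<in> U"
      using U(1,2) c(2) by (simp add: topological_tendstoD eventually_nhds_conv_at isCont_def)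
    with c(3) have inS: "\<forall>\<^sub>F s in nhds 0. \<phi> (c s) \<in> S"
      by eventually_elim (use S(2) in blast)
    have "((\<lambda>s. \<phi> (c s)) has_derivative (\<lambda>h. A (h *\<^sub>R v))) (at 0)"
      using diff_chain_at[of c "\<lambda>h. h *\<^sub>R v" 0 \<phi> A] c A
      by (simp add: has_vector_derivative_def o_def)
    then have "((\<lambda>s. \<phi> (c s)) has_vector_derivative A v) (at 0)"
      using linear_scale[OF lin(1)] by (simp add: has_vector_derivative_def)
    then have der: "((\<lambda>s. \<phi> (c s) \<bullet> w) has_real_derivative A v \<bullet> w) (at 0)" for w
      using has_derivative_inner_left[of "\<lambda>s. \<phi> (c s)" "\<lambda>h. h *\<^sub>R A v" "at 0" w]
      by (simp add: has_vector_derivative_def has_field_derivative_def mult_commute_abs)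
    have orth: "A v \<bullet> w = 0" if w: "\<And>x. x \<in> S \<Longrightarrow> orthogonal w x" for w
    proof -
      from inS have "\<forall>\<^sub>F s in nhds 0. \<phi> (c s) \<bullet> w = 0"
      proof eventually_elim
        case (elim s)
        then show ?case using w[OF elim] by (simp add: orthogonal_def inner_commute)
      qed
      then have "((\<lambda>s. \<phi> (c s) \<bullet> w) has_real_derivative A v \<bullet> w) (at 0) \<longleftrightarrow>
          ((\<lambda>s. 0) has_real_derivative A v \<bullet> w) (at 0)"
        by (intro DERIV_cong_ev) auto
      with der have "((\<lambda>s::real. 0) has_real_derivative A v \<bullet> w) (at 0)" by blast
      then show ?thesis using DERIV_unique[OF _ DERIV_const] by blast
    qed
    obtain y z where y: "y \<in> span S" and z: "\<And>x. x \<in> span S \<Longrightarrow> orthogonal z x" and "A v = y + z"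
      using orthogonal_subspace_decomp_exists[of S "A v"] by metis
    have "span S = S" using S(1) by (simp add: span_eq_iff)
    have "A v \<bullet> z = 0" by (rule orth) (use z span_base in blast)
    moreover have "y \<bullet> z = 0" using z[OF y] by (simp add: orthogonal_def inner_commute)
    moreover have "A v \<bullet> z = y \<bullet> z + z \<bullet> z" using \<open>A v = y + z\<close> by (simp add: inner_add_left)
    ultimately have "z \<bullet> z = 0" by linarith
    then have "z = 0" by simp
    then show ?thesis using \<open>A v = y + z\<close> y \<open>span S = S\<close> by simp
  qed
  have "tangent_space M p = D ` S"
  proof (intro equalityI subsetI)
    fix v assume "v \<in> tangent_space M p"
    then show "v \<in> D ` S" using AS DA by (metis imageI)
  next
    fix v assume "v \<in> D ` S"
    then show "v \<in> tangent_space M p"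
      using embedded_submanifold_chart_tangent[OF U sm(2) S p D] by blast
  qed
  then show ?thesis using linear_subspace_image[OF lin(2) S(1)] by simp
qed

text \<open>The tangential part of the gradient is orthogonal to all the \<open>b i p\<close>, so the spanning inequality
forces it to vanish.\<close>

lemma Crit_if_nabla_orthogonal_spanning_fields:
  fixes b :: "'r::finite \<Rightarrow> 'a::euclidean_space \<Rightarrow> 'a"
  assumes sub: "subspace (tangent_space M p)" and p: "p \<in> M"
    and tan: "\<And>i. b i p \<in> tangent_space M p"
    and lam: "lam > 0" "\<And>v. v \<in> tangent_space M p \<Longrightarrow> (\<Sum>i\<in>UNIV. (b i p \<bullet> v)\<^sup>2) \<ge> lam * (v \<bullet> v)"
    and zero: "\<And>i. nabla M W p \<bullet> b i p = 0"
  shows "p \<in> Crit M W"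
proof -
  obtain u w where u: "u \<in> span (tangent_space M p)"
    and w: "\<And>v. v \<in> span (tangent_space M p) \<Longrightarrow> orthogonal w v" and n: "nabla M W p = u + w"
    using orthogonal_subspace_decomp_exists[of "tangent_space M p" "nabla M W p"] by metis
  have span: "span (tangent_space M p) = tangent_space M p" using sub by (simp add: span_eq_iff)
  have "b i p \<bullet> u = 0" for i
    using zero[of i] w[unfolded span, OF tan[of i]] n
    by (simp add: orthogonal_def inner_add_left inner_commute)
  then have "lam * (u \<bullet> u) \<le> 0" using lam(2)[of u] u span by simp
  then have "u \<bullet> u \<le> 0" using lam(1) by (simp add: mult_le_0_iff)
  then have "u = 0" using inner_ge_zero[of u] by (simp add: order_antisym)
  then have "nabla M W p = w" using n by simp
  then show ?thesis
    using w p by (auto simp: Crit_def orthogonal_comp_def span orthogonal_commute)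
qed

section \<open>Comparison functions of class K-infinity\<close>

lemma class_K_inf_mono:
  assumes "class_K_inf f" "0 \<le> r" "r \<le> s"
  shows "f r \<le> f s"
  using assms strict_mono_on_leD[of "{0..}" f r s] by (simp add: class_K_inf_def)

lemma class_K_inf_pos:
  assumes "class_K_inf f" "0 < r"
  shows "0 < f r"
  using assms strict_mono_onD[of "{0..}" f 0 r] by (simp add: class_K_inf_def)

lemma class_K_inf_nonneg:
  assumes "class_K_inf f" "0 \<le> r"
  shows "0 \<le> f r"
  using class_K_inf_mono[OF assms(1), of 0 r] assms by (simp add: class_K_inf_def)

lemma class_K_inf_tendsto_0:
  assumes "class_K_inf f"
  shows "(f \<longlongrightarrow> 0) (at_right 0)"
proof -
  have cont: "continuous_on {0..} f" and f0: "f 0 = 0" using assms by (simp_all add: class_K_inf_def)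
  have "(f \<longlongrightarrow> f 0) (at 0 within {0..})"
    by (rule bspec[OF cont[unfolded continuous_on_def]]) simp
  then show ?thesis unfolding f0 by (rule tendsto_within_subset) auto
qed

text \<open>The least monotone majorant \<open>r \<mapsto> sup {f x | g x \<le> r}\<close> may be discontinuous. Replacing the sharp
cut-off at \<open>g x = r\<close> by a weight that falls linearly from 1 at \<open>g x = r\<close> to 0 at \<open>g x = 2 * r\<close> makes
the supremum locally Lipschitz in \<open>r > 0\<close>, and smallness of \<open>f\<close> for small \<open>g\<close> makes it continuous at 0;
adding \<open>r\<close> makes it strictly increasing and unbounded.\<close>

lemma class_K_inf_majorant:
  fixes f g :: "'a \<Rightarrow> real"
  assumes bounded: "\<And>r. \<exists>B. \<forall>x\<in>X. g x \<le> r \<longrightarrow> f x \<le> B"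
    and small: "\<And>\<epsilon>. \<epsilon> > 0 \<Longrightarrow> \<exists>d>0. \<forall>x\<in>X. g x \<le> d \<longrightarrow> f x \<le> \<epsilon>"
    and g: "\<And>x. x \<in> X \<Longrightarrow> g x \<ge> 0"
  shows "\<exists>\<alpha>. class_K_inf \<alpha> \<and> (\<forall>x\<in>X. f x \<le> \<alpha> (g x))"
proof -
  define w where "w = (\<lambda>x r. max 0 (f x) * max 0 (min 1 (2 - g x / r)))"
  define \<sigma> where "\<sigma> = (\<lambda>r. Sup (insert 0 ((\<lambda>x. w x r) ` X)))"
  define \<alpha> where "\<alpha> = (\<lambda>r. if r \<le> 0 then 0 else r + \<sigma> r)"
  have w_nonneg: "0 \<le> w x r" for x r by (simp add: w_def)
  have w_le: "w x r \<le> max 0 (f x)" for x r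
    by (auto simp: w_def intro!: mult_left_le)
  have w_0: "w x r = 0" if "r > 0" "g x \<ge> 2 * r" for x r
    using that by (simp add: w_def field_simps)
  have w_mono: "w x r \<le> w x s" if "x \<in> X" "0 < r" "r \<le> s" for x r s
  proof -
    have "g x / s \<le> g x / r" using g[OF that(1)] that by (intro divide_left_mono) auto
    then show ?thesis unfolding w_def by (intro mult_left_mono) auto
  qed
  have w_bound: "w x r \<le> B" if "x \<in> X" "r > 0" "r \<le> R" "B \<ge> 0" "\<forall>x\<in>X. g x \<le> 2 * R \<longrightarrow> f x \<le> B" for x r R B
  proof (cases "g x \<le> 2 * R")
    case True then show ?thesis using w_le[of x r] that by fastforce
  next
    case False then show ?thesis using w_0[of r x] that by simp
  qed
  have B: "\<exists>B\<ge>0. \<forall>x\<in>X. g x \<le> R \<longrightarrow> f x \<le> B" for R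
  proof -
    obtain B where "\<forall>x\<in>X. g x \<le> R \<longrightarrow> f x \<le> B" using bounded by blast
    then show ?thesis by (intro exI[of _ "max 0 B"]) fastforce
  qed
  have bdd: "bdd_above (insert 0 ((\<lambda>x. w x r) ` X))" if r: "r > 0" for r
  proof -
    obtain C where "C \<ge> 0" "\<forall>x\<in>X. g x \<le> 2 * r \<longrightarrow> f x \<le> C" using B by blast
    then have "w x r \<le> C" if "x \<in> X" for x using w_bound[OF that r] by blast
    then show ?thesis using \<open>C \<ge> 0\<close> by (intro bdd_aboveI[of _ C]) auto
  qed
  have \<sigma>_le: "\<sigma> r \<le> C" if "\<And>x. x \<in> X \<Longrightarrow> w x r \<le> C" "C \<ge> 0" for r C
    unfolding \<sigma>_def using that by (intro cSup_least) auto
  have \<sigma>_ge: "w x r \<le> \<sigma> r" if "r > 0" "x \<in> X" for x r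
    unfolding \<sigma>_def using bdd[OF that(1)] that(2) by (intro cSup_upper) auto
  have \<sigma>_nonneg: "0 \<le> \<sigma> r" if "r > 0" for r
    unfolding \<sigma>_def using bdd[OF that] by (intro cSup_upper) auto
  have \<sigma>_mono: "\<sigma> r \<le> \<sigma> s" if "0 < r" "r \<le> s" for r s
  proof (rule \<sigma>_le)
    fix x assume x: "x \<in> X"
    have "w x r \<le> w x s" by (rule w_mono[OF x that])
    also have "\<dots> \<le> \<sigma> s" using \<sigma>_ge x that by simp
    finally show "w x r \<le> \<sigma> s" .
  qed (use \<sigma>_nonneg that in simp)
  have \<sigma>_lip: "\<exists>L. L-lipschitz_on {a..b} \<sigma>" if ab: "0 < a" "a \<le> b" for a b
  proof -
    obtain C where C: "C \<ge> 0" "\<forall>x\<in>X. g x \<le> 2 * b \<longrightarrow> f x \<le> C" using B by blast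
    let ?L = "C * (2 * b / a\<^sup>2)"
    have L: "?L \<ge> 0" using C ab by simp
    have le: "\<sigma> r \<le> \<sigma> s + ?L * \<bar>r - s\<bar>" if rs: "r \<in> {a..b}" "s \<in> {a..b}" for r s
    proof (rule \<sigma>_le)
      fix x assume x: "x \<in> X"
      have rs0: "r > 0" "s > 0" using rs ab by auto
      have "w x r \<le> w x s + ?L * \<bar>r - s\<bar>"
      proof (cases "g x \<le> 2 * b")
        case True
        have "g x / s - g x / r = g x * ((r - s) / (r * s))" using rs0 by (simp add: field_simps)
        also have "\<dots> \<le> g x * (\<bar>r - s\<bar> / a\<^sup>2)"
        proof (rule mult_left_mono)
          have "(r - s) / (r * s) \<le> \<bar>r - s\<bar> / (r * s)" using rs0 by (intro divide_right_mono) auto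
          also have "\<dots> \<le> \<bar>r - s\<bar> / a\<^sup>2"
            using rs rs0 ab unfolding power2_eq_square by (intro divide_left_mono mult_mono) auto
          finally show "(r - s) / (r * s) \<le> \<bar>r - s\<bar> / a\<^sup>2" .
        qed (rule g[OF x])
        also have "\<dots> \<le> 2 * b * (\<bar>r - s\<bar> / a\<^sup>2)" using True by (intro mult_right_mono) auto
        finally have gle: "g x / s - g x / r \<le> 2 * b * (\<bar>r - s\<bar> / a\<^sup>2)" .
        have fC: "max 0 (f x) \<le> C" using True x C by auto
        let ?cl = "\<lambda>r. max 0 (min 1 (2 - g x / r))"
        have "?cl r \<le> ?cl s + max 0 (g x / s - g x / r)" by (auto simp: max_def min_def)
        also have "\<dots> \<le> ?cl s + 2 * b * (\<bar>r - s\<bar> / a\<^sup>2)" using gle ab by simp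
        finally have "w x r \<le> max 0 (f x) * (?cl s + 2 * b * (\<bar>r - s\<bar> / a\<^sup>2))"
          unfolding w_def by (intro mult_left_mono) auto
        also have "\<dots> = w x s + max 0 (f x) * (2 * b * (\<bar>r - s\<bar> / a\<^sup>2))"
          by (simp add: w_def distrib_left)
        also have "\<dots> \<le> w x s + C * (2 * b * (\<bar>r - s\<bar> / a\<^sup>2))"
          using fC ab by (intro add_left_mono mult_right_mono) auto
        finally show ?thesis by simp
      next
        case False
        then have "w x r = 0" using w_0[of r x] rs rs0 by simp
        then show ?thesis using w_nonneg[of x s] mult_nonneg_nonneg[OF L abs_ge_zero[of "r - s"]] by linarith
      qed
      also have "\<dots> \<le> \<sigma> s + ?L * \<bar>r - s\<bar>" using \<sigma>_ge[OF rs0(2) x] by simp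
      finally show "w x r \<le> \<sigma> s + ?L * \<bar>r - s\<bar>" .
    next
      show "0 \<le> \<sigma> s + ?L * \<bar>r - s\<bar>"
        using \<sigma>_nonneg[of s] rs ab by (intro add_nonneg_nonneg mult_nonneg_nonneg[OF L]) auto
    qed
    show ?thesis
    proof (intro exI lipschitz_onI)
      fix r s assume "r \<in> {a..b}" "s \<in> {a..b}"
      then show "dist (\<sigma> r) (\<sigma> s) \<le> ?L * dist r s"
        using le[of r s] le[of s r] by (auto simp: dist_real_def abs_le_iff abs_minus_commute)
    qed (rule L)
  qed
  have \<sigma>_cont: "isCont \<sigma> r" if r: "r > 0" for r
  proof -
    have "continuous_on {r / 2..2 * r} \<sigma>"
      using \<sigma>_lip[of "r / 2" "2 * r"] r lipschitz_on_continuous_on by fastforce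
    then have "continuous_on {r / 2<..<2 * r} \<sigma>"
      by (rule continuous_on_subset) auto
    then show ?thesis using r by (simp add: continuous_on_eq_continuous_at)
  qed
  have "continuous_on {0..} \<alpha>"
    unfolding continuous_on_eq_continuous_within
  proof
    fix r :: real assume "r \<in> {0..}"
    then consider "r = 0" | "r > 0" by fastforce
    then show "continuous (at r within {0..}) \<alpha>"
    proof cases
      case 1
      have "\<exists>d>0. \<forall>s\<in>{0..}. dist s 0 < d \<longrightarrow> dist (\<alpha> s) (\<alpha> 0) < \<epsilon>" if "\<epsilon> > 0" for \<epsilon>
      proof -
        have "\<epsilon> / 2 > 0" using that by simp
        from small[OF this] obtain d where d: "d > 0" "\<forall>x\<in>X. g x \<le> d \<longrightarrow> f x \<le> \<epsilon> / 2" by blast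
        have "\<alpha> s < \<epsilon>" if s: "s > 0" "s < min (d / 2) (\<epsilon> / 2)" for s
        proof -
          have "w x s \<le> \<epsilon> / 2" if "x \<in> X" for x
            by (rule w_bound[OF that s(1), of "d / 2"]) (use s d \<open>\<epsilon> > 0\<close> in auto)
          then have "\<sigma> s \<le> \<epsilon> / 2" using \<open>\<epsilon> > 0\<close> by (intro \<sigma>_le) auto
          then show ?thesis using s by (simp add: \<alpha>_def)
        qed
        moreover have \<alpha>0: "\<alpha> s \<ge> 0" "\<alpha> 0 = 0" for s using \<sigma>_nonneg[of s] by (auto simp: \<alpha>_def)
        ultimately have "\<bar>\<alpha> s\<bar> < \<epsilon>" if "s \<ge> 0" "s < min (d / 2) (\<epsilon> / 2)" for s
          using that \<open>\<epsilon> > 0\<close> by (cases "s = 0") auto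
        then show ?thesis using d(1) that \<alpha>0(2)
          by (intro exI[of _ "min (d / 2) (\<epsilon> / 2)"]) (auto simp: dist_real_def)
      qed
      then show ?thesis using 1 by (simp add: continuous_within_eps_delta)
    next
      case 2
      have "\<forall>\<^sub>F s in nhds r. s \<in> {0<..}" using 2 by (intro eventually_nhds_in_open) auto
      then have "\<forall>\<^sub>F s in nhds r. \<alpha> s = s + \<sigma> s" by eventually_elim (simp add: \<alpha>_def)
      moreover have "isCont (\<lambda>s. s + \<sigma> s) r" using \<sigma>_cont[OF 2] by (intro continuous_intros)
      ultimately have "isCont \<alpha> r" using isCont_cong[of \<alpha> "\<lambda>s. s + \<sigma> s" r] by blast
      then show ?thesis by (rule continuous_at_imp_continuous_at_within)
    qed
  qed
  moreover have "strict_mono_on {0..} \<alpha>"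
  proof (rule strict_mono_onI)
    fix r s :: real assume "r \<in> {0..}" "s \<in> {0..}" "r < s"
    then show "\<alpha> r < \<alpha> s" using \<sigma>_mono[of r s] \<sigma>_nonneg[of s] by (auto simp: \<alpha>_def)
  qed
  moreover have "\<alpha> 0 = 0" by (simp add: \<alpha>_def)
  moreover have "filterlim \<alpha> at_top at_top"
  proof (rule filterlim_at_top_mono[OF filterlim_ident])
    show "\<forall>\<^sub>F r in at_top. r \<le> \<alpha> r"
      using eventually_gt_at_top[of 0] by eventually_elim (use \<sigma>_nonneg in \<open>simp add: \<alpha>_def\<close>)
  qed
  ultimately have "class_K_inf \<alpha>" by (simp add: class_K_inf_def)
  moreover have "f x \<le> \<alpha> (g x)" if x: "x \<in> X" for x
  proof (cases "g x = 0")
    case True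
    have "f x \<le> 0 + \<epsilon>" if "\<epsilon> > 0" for \<epsilon>
      using small[OF that] x True by (force simp: less_imp_le)
    then have "f x \<le> 0" by (rule field_le_epsilon)
    then show ?thesis using True by (simp add: \<alpha>_def)
  next
    case False
    then have pos: "g x > 0" using g[OF x] by simp
    then have "f x \<le> w x (g x)" by (simp add: w_def)
    also have "\<dots> \<le> \<sigma> (g x)" by (rule \<sigma>_ge[OF pos x])
    also have "\<dots> \<le> \<alpha> (g x)" using pos by (simp add: \<alpha>_def)
    finally show ?thesis .
  qed
  ultimately show ?thesis by blast
qed

text \<open>This form applies in both directions to a proper positive definite function and the distance to its
zero set: the upper bound is read off directly, and the lower one after inverting the majorant.\<close>

lemma class_K_inf_majorant_proper:
  fixes f g :: "'a::metric_space \<Rightarrow> real"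
  assumes f: "continuous_on X f" and g: "continuous_on X g" "\<And>x. x \<in> X \<Longrightarrow> g x \<ge> 0"
    and proper: "\<And>r. compact {x \<in> X. g x \<le> r}"
    and zero: "\<And>x. x \<in> X \<Longrightarrow> g x = 0 \<Longrightarrow> f x \<le> 0"
  shows "\<exists>\<alpha>. class_K_inf \<alpha> \<and> (\<forall>x\<in>X. f x \<le> \<alpha> (g x))"
proof (rule class_K_inf_majorant)
  fix r
  have "continuous_on {x \<in> X. g x \<le> r} f" by (rule continuous_on_subset[OF f]) auto
  then have "bounded (f ` {x \<in> X. g x \<le> r})"
    using proper compact_continuous_image compact_imp_bounded by blast
  then obtain B where "\<forall>y\<in>f ` {x \<in> X. g x \<le> r}. norm y \<le> B" unfolding bounded_iff by blast
  then show "\<exists>B. \<forall>x\<in>X. g x \<le> r \<longrightarrow> f x \<le> B" by (intro exI[of _ B]) (auto simp: abs_le_iff)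
next
  fix \<epsilon> :: real assume \<epsilon>: "\<epsilon> > 0"
  let ?C = "{x \<in> {x \<in> X. g x \<le> 1}. \<epsilon> \<le> f x}"
  have "continuous_on {x \<in> X. g x \<le> 1} f" by (rule continuous_on_subset[OF f]) auto
  then have "closed ?C"
    by (intro continuous_on_closed_Collect_le continuous_on_const compact_imp_closed proper)
  then have "compact ({x \<in> X. g x \<le> 1} \<inter> ?C)" by (rule compact_Int_closed[OF proper])
  moreover have "{x \<in> X. g x \<le> 1} \<inter> ?C = ?C" by auto
  ultimately have C: "compact ?C" by simp
  show "\<exists>d>0. \<forall>x\<in>X. g x \<le> d \<longrightarrow> f x \<le> \<epsilon>"
  proof (cases "?C = {}")
    case True
    then show ?thesis by (intro exI[of _ 1]) force
  next
    case False
    have "continuous_on ?C g" by (rule continuous_on_subset[OF g(1)]) auto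
    from continuous_attains_inf[OF C False this] obtain y where y: "y \<in> ?C" "\<forall>x\<in>?C. g y \<le> g x"
      by blast
    have "g y > 0" using y(1) g(2)[of y] zero[of y] \<epsilon> by fastforce
    moreover have "f x \<le> \<epsilon>" if "x \<in> X" "g x \<le> min 1 (g y / 2)" for x
    proof (rule ccontr)
      assume "\<not> f x \<le> \<epsilon>"
      then have "x \<in> ?C" using that by simp
      then show False using y(2) that \<open>g y > 0\<close> by fastforce
    qed
    ultimately show ?thesis by (intro exI[of _ "min 1 (g y / 2)"]) auto
  qed
qed (rule g(2))

lemma class_K_inf_inverse:
  assumes \<eta>: "class_K_inf \<eta>"
  shows "\<exists>\<alpha>. class_K_inf \<alpha> \<and> (\<forall>r\<ge>0. \<forall>s\<ge>0. r \<le> \<eta> s \<longrightarrow> \<alpha> r \<le> s)"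
proof -
  have cont: "continuous_on {0..} \<eta>" and sm: "strict_mono_on {0..} \<eta>" and e0: "\<eta> 0 = 0"
    and lim: "filterlim \<eta> at_top at_top" using \<eta> by (auto simp: class_K_inf_def)
  have less: "\<eta> r < \<eta> s \<longleftrightarrow> r < s" if "r \<ge> 0" "s \<ge> 0" for r s
    using sm that by (simp add: strict_mono_on_less)
  have "\<exists>s\<ge>0. \<eta> s = r" if r: "r \<ge> 0" for r
  proof -
    have "\<forall>\<^sub>F s in at_top. r \<le> \<eta> s \<and> 0 \<le> s"
      using lim eventually_ge_at_top[of 0] by (auto simp: filterlim_at_top eventually_conj_iff)
    then obtain b where b: "r \<le> \<eta> b" "0 \<le> b"
      using eventually_happens'[OF trivial_limit_at_top_linorder] by blast
    have "continuous_on {0..b} \<eta>" using cont by (rule continuous_on_subset) auto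
    then show ?thesis using IVT'[of \<eta> 0 r b] b e0 r by auto
  qed
  then obtain \<alpha> where \<alpha>: "\<And>r. r \<ge> 0 \<Longrightarrow> \<alpha> r \<ge> 0" "\<And>r. r \<ge> 0 \<Longrightarrow> \<eta> (\<alpha> r) = r" by metis
  have \<alpha>\<eta>: "\<alpha> (\<eta> s) = s" if s: "s \<ge> 0" for s
  proof -
    have "\<eta> s \<ge> 0" using less[of s 0] s e0 by (auto simp: not_less[symmetric])
    then show ?thesis using \<alpha>[of "\<eta> s"] less[of "\<alpha> (\<eta> s)" s] less[of s "\<alpha> (\<eta> s)"] s by auto
  qed
  have adj: "\<alpha> r \<le> s \<longleftrightarrow> r \<le> \<eta> s" if "r \<ge> 0" "s \<ge> 0" for r s
    using less[of s "\<alpha> r"] \<alpha> that by (auto simp: not_less[symmetric])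
  have mono: "\<alpha> r < \<alpha> s" if "r \<ge> 0" "r < s" for r s
    using less[of "\<alpha> r" "\<alpha> s"] \<alpha>[of r] \<alpha>[of s] that by simp
  have "continuous_on {0..} \<alpha>"
    unfolding continuous_on_iff
  proof (intro ballI allI impI)
    fix r \<epsilon> :: real assume r: "r \<in> {0..}" and "\<epsilon> > 0"
    define y where "y = \<alpha> r"
    have y: "y \<ge> 0" "\<eta> y = r" using \<alpha> r by (auto simp: y_def)
    \<comment> \<open>For \<open>y < \<epsilon>\<close> the lower bound \<open>y - \<epsilon> < \<alpha> s\<close> holds for all \<open>s\<close>, since \<open>\<alpha>\<close> is nonnegative.\<close>
    define d where "d = min (\<eta> (y + \<epsilon>) - r) (if y < \<epsilon> then 1 else r - \<eta> (y - \<epsilon>))"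
    have "r < \<eta> (y + \<epsilon>)" using less[of y "y + \<epsilon>"] y \<open>\<epsilon> > 0\<close> by simp
    moreover have "\<eta> (y - \<epsilon>) < r" if "\<not> y < \<epsilon>"
      using less[of "y - \<epsilon>" y] y \<open>\<epsilon> > 0\<close> that by simp
    ultimately have "d > 0" by (simp add: d_def)
    moreover have "\<bar>\<alpha> s - y\<bar> < \<epsilon>" if s: "s \<ge> 0" "\<bar>s - r\<bar> < d" for s
    proof -
      have "s < \<eta> (y + \<epsilon>)" using s by (simp add: d_def abs_if split: if_splits)
      then have "\<alpha> s < y + \<epsilon>" using less[of "\<alpha> s" "y + \<epsilon>"] \<alpha>[OF s(1)] y \<open>\<epsilon> > 0\<close> by simp
      moreover have "y - \<epsilon> < \<alpha> s"
      proof (cases "y < \<epsilon>")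
        case True
        then show ?thesis using \<alpha>(1)[OF s(1)] by simp
      next
        case False
        then have "\<eta> (y - \<epsilon>) < s" using s by (simp add: d_def abs_if split: if_splits)
        then show ?thesis using less[of "y - \<epsilon>" "\<alpha> s"] \<alpha>[OF s(1)] False by simp
      qed
      ultimately show ?thesis by (simp add: abs_less_iff)
    qed
    ultimately show "\<exists>d>0. \<forall>s\<in>{0..}. dist s r < d \<longrightarrow> dist (\<alpha> s) (\<alpha> r) < \<epsilon>"
      by (intro exI[of _ d]) (simp add: dist_real_def y_def)
  qed
  moreover have "strict_mono_on {0..} \<alpha>" by (rule strict_mono_onI) (use mono in auto)
  moreover have "\<alpha> 0 = 0" using \<alpha>\<eta>[of 0] e0 by simp
  moreover have "filterlim \<alpha> at_top at_top"
    unfolding filterlim_at_top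
  proof
    fix Z :: real
    have "\<forall>\<^sub>F r in at_top. max (\<eta> (max 0 Z)) 0 \<le> r" by (rule eventually_ge_at_top)
    then show "\<forall>\<^sub>F r in at_top. Z \<le> \<alpha> r"
    proof eventually_elim
      case (elim r)
      then show ?case using less[of "\<alpha> r" "max 0 Z"] \<alpha>[of r] by auto
    qed
  qed
  ultimately have "class_K_inf \<alpha>" by (simp add: class_K_inf_def)
  then show ?thesis using adj by blast
qed

section \<open>Monotone quantities along hybrid solutions\<close>

text \<open>Truncated at a point of the domain, the domain is a chain of intervals that ends at that point. The
domain as a whole need not be such a chain: an interval may continue beyond an instant from which a
jump leaves.\<close>

lemma hybrid_time_domain_cover:
  assumes E: "hybrid_time_domain E" and TJ: "(T, J) \<in> E"
  shows "\<exists>\<tau>::nat \<Rightarrow> real. \<tau> 0 = 0 \<and> (\<forall>j\<le>J. \<tau> j \<le> \<tau> (Suc j)) \<and> \<tau> (Suc J) = T \<and>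
    E \<inter> ({0..T} \<times> {0..J}) = (\<Union>j\<le>J. {\<tau> j..\<tau> (Suc j)} \<times> {j})"
proof -
  have pos: "E \<subseteq> {0..} \<times> UNIV"
    and "compact_hybrid_time_domain (E \<inter> ({0..T} \<times> {0..J}))"
    using E TJ unfolding hybrid_time_domain_def by blast+
  then obtain K \<tau> where \<tau>: "\<tau> 0 = 0" "\<forall>j<K. \<tau> j \<le> \<tau> (Suc j)"
    and eq: "E \<inter> ({0..T} \<times> {0..J}) = (\<Union>j<K. {\<tau> j..\<tau> (Suc j)} \<times> {j})"
    unfolding compact_hybrid_time_domain_def by blast
  have "(T, J) \<in> (\<Union>j<K. {\<tau> j..\<tau> (Suc j)} \<times> {j})"
    using TJ pos unfolding eq[symmetric] by auto
  then have J: "J < K" "\<tau> J \<le> T" "T \<le> \<tau> (Suc J)" by auto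
  have end_in: "(\<tau> (Suc j), j) \<in> E \<inter> ({0..T} \<times> {0..J})" if "j < K" for j
    unfolding eq using that \<tau>(2) by auto
  have "K = Suc J" using end_in[of "K - 1"] J by auto
  moreover have "\<tau> (Suc J) = T" using end_in[of J] J by auto
  ultimately show ?thesis
    using \<tau> eq by (intro exI[of _ \<tau>]) (simp add: less_Suc_eq_le lessThan_Suc_atMost)
qed

text \<open>At interior points the derivative within the interval of flow is a two-sided derivative, and the
endpoints are negligible.\<close>

lemma hybrid_solution_flow:
  assumes sol: "hybrid_solution H E z" and ab: "a < b" and arc: "{a..b} \<times> {j} \<subseteq> E"
  shows "abs_continuous_on {a..b} (\<lambda>t. z t j)"
    and "\<And>t. t \<in> {a..b} \<Longrightarrow> z t j \<in> flow_set H"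
    and "AE t in lebesgue. t \<in> {a<..<b} \<longrightarrow>
      (\<exists>v\<in>flow_map H (z t j). ((\<lambda>s. z s j) has_vector_derivative v) (at t))"
proof -
  let ?I = "{t. (t, j) \<in> E}"
  have sub: "{a..b} \<subseteq> ?I" using arc by auto
  have int: "{a<..<b} \<subseteq> interior ?I" by (intro interior_maximal subset_trans[OF _ sub]) auto
  then have "interior ?I \<noteq> {}" using ab by (metis dense empty_iff greaterThanLessThan_iff subsetD)
  then have *: "loc_abs_continuous_on ?I (\<lambda>t. z t j)" "\<forall>t\<in>?I. z t j \<in> flow_set H"
    "AE t in lebesgue. t \<in> ?I \<longrightarrow>
      (\<exists>v\<in>flow_map H (z t j). ((\<lambda>s. z s j) has_vector_derivative v) (at t within ?I))"
    using sol unfolding hybrid_solution_def Let_def by blast+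
  show "abs_continuous_on {a..b} (\<lambda>t. z t j)"
    using *(1) sub unfolding loc_abs_continuous_on_def by blast
  show "z t j \<in> flow_set H" if "t \<in> {a..b}" for t using *(2) sub that by blast
  show "AE t in lebesgue. t \<in> {a<..<b} \<longrightarrow>
      (\<exists>v\<in>flow_map H (z t j). ((\<lambda>s. z s j) has_vector_derivative v) (at t))"
    using *(3)
  proof (rule eventually_mono, intro impI)
    fix t assume ex: "t \<in> ?I \<longrightarrow>
      (\<exists>v\<in>flow_map H (z t j). ((\<lambda>s. z s j) has_vector_derivative v) (at t within ?I))"
      and t: "t \<in> {a<..<b}"
    have t': "t \<in> interior ?I" using int t by blast
    then have "t \<in> ?I" using interior_subset by blast
    with ex show "\<exists>v\<in>flow_map H (z t j). ((\<lambda>s. z s j) has_vector_derivative v) (at t)"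
      unfolding at_within_interior[OF t'] by (rule mp)
  qed
qed

lemma hybrid_solution_jump:
  assumes "hybrid_solution H E z" "(t, j) \<in> E" "(t, Suc j) \<in> E"
  shows "z t j \<in> jump_set H" "z t (Suc j) \<in> jump_map H (z t j)"
proof -
  have "\<forall>t j. (t, j) \<in> E \<and> (t, Suc j) \<in> E \<longrightarrow>
      z t j \<in> jump_set H \<and> z t (Suc j) \<in> jump_map H (z t j)"
    using assms(1) unfolding hybrid_solution_def by (elim conjE)
  then show "z t j \<in> jump_set H" "z t (Suc j) \<in> jump_map H (z t j)" using assms(2,3) by simp_all
qed

text \<open>A point of the domain either ends an interval of flow of positive length, is the initial point, or
is reached by a jump.\<close>

lemma hybrid_solution_viable:
  assumes sol: "hybrid_solution H E z"
    and sets: "flow_set H \<union> jump_set H \<subseteq> Y"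
    and jump: "\<And>\<xi>. \<xi> \<in> jump_set H \<Longrightarrow> jump_map H \<xi> \<subseteq> Y"
    and TJ: "(T, J) \<in> E"
  shows "z T J \<in> Y"
proof -
  have "hybrid_time_domain E" using sol by (simp add: hybrid_solution_def)
  from hybrid_time_domain_cover[OF this TJ] obtain \<tau> :: "nat \<Rightarrow> real" where \<tau>': "\<tau> 0 = 0"
      "\<forall>j\<le>J. \<tau> j \<le> \<tau> (Suc j)" "\<tau> (Suc J) = T"
    and eq: "E \<inter> ({0..T} \<times> {0..J}) = (\<Union>j\<le>J. {\<tau> j..\<tau> (Suc j)} \<times> {j})" by blast
  then have \<tau>: "\<tau> 0 = 0" "\<And>j. j \<le> J \<Longrightarrow> \<tau> j \<le> \<tau> (Suc j)" "\<tau> (Suc J) = T" by blast+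
  have arc: "{\<tau> j..\<tau> (Suc j)} \<times> {j} \<subseteq> E" if "j \<le> J" for j using eq that by blast
  consider "\<tau> J < T" | "\<tau> J = T" "J = 0" | K where "\<tau> J = T" "J = Suc K"
    using \<tau>(2)[of J] \<tau>(3) by (cases J) force+
  then show ?thesis
  proof cases
    case 1
    then show ?thesis using hybrid_solution_flow(2)[OF sol 1, of J T] arc[of J] \<tau>(3) sets by auto
  next
    case 2
    then show ?thesis using sol sets \<tau>(1) by (auto simp: hybrid_solution_def)
  next
    case 3
    have "(T, K) \<in> E" using arc[of K] \<tau>(2)[of K] 3 by auto
    then show ?thesis using hybrid_solution_jump[OF sol, of T K] TJ 3 jump by blast
  qed
qed

text \<open>The infinitesimal conditions are only required on a set \<open>P\<close> in which the solution is known to remain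
up to \<open>(T, J)\<close>; this allows decrease estimates that hold only on a part of the state space. The flow
condition is phrased with curves because \<open>\<Psi>\<close> need not be differentiable in the ambient space.\<close>

lemma hybrid_solution_decrease:
  fixes \<Psi> :: "'z::real_normed_vector \<Rightarrow> real"
  assumes sol: "hybrid_solution H E z"
    and lip: "\<And>K. compact K \<Longrightarrow> K \<subseteq> flow_set H \<Longrightarrow> \<exists>L. L-lipschitz_on K \<Psi>"
    and flow: "\<And>c v t. c t \<in> P \<Longrightarrow> \<forall>\<^sub>F s in nhds t. c s \<in> flow_set H \<Longrightarrow> v \<in> flow_map H (c t) \<Longrightarrow>
      (c has_vector_derivative v) (at t) \<Longrightarrow>
      \<exists>m\<le>- k. ((\<lambda>s. \<Psi> (c s)) has_real_derivative m) (at t)"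
    and jump: "\<And>\<xi> \<xi>'. \<xi> \<in> P \<Longrightarrow> \<xi> \<in> jump_set H \<Longrightarrow> \<xi>' \<in> jump_map H \<xi> \<Longrightarrow> \<Psi> \<xi>' \<le> \<Psi> \<xi> - k"
    and TJ: "(T, J) \<in> E" and S: "(t0, j0) \<in> E" "t0 \<le> T" "j0 \<le> J"
    and P: "\<And>t j. (t, j) \<in> E \<Longrightarrow> t \<le> T \<Longrightarrow> j \<le> J \<Longrightarrow> z t j \<in> P"
  shows "\<Psi> (z T J) + k * (T + real J) \<le> \<Psi> (z t0 j0) + k * (t0 + real j0)"
proof -
  have htd: "hybrid_time_domain E" using sol by (simp add: hybrid_solution_def)
  from hybrid_time_domain_cover[OF this TJ] obtain \<tau> :: "nat \<Rightarrow> real" where \<tau>': "\<tau> 0 = 0"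
      "\<forall>j\<le>J. \<tau> j \<le> \<tau> (Suc j)" "\<tau> (Suc J) = T"
    and eq: "E \<inter> ({0..T} \<times> {0..J}) = (\<Union>j\<le>J. {\<tau> j..\<tau> (Suc j)} \<times> {j})" by blast
  then have \<tau>: "\<tau> 0 = 0" "\<And>j. j \<le> J \<Longrightarrow> \<tau> j \<le> \<tau> (Suc j)" "\<tau> (Suc J) = T" by blast+
  have arc: "{\<tau> j..\<tau> (Suc j)} \<times> {j} \<subseteq> E \<inter> ({0..T} \<times> {0..J})" if "j \<le> J" for j
    using eq that by blast
  have \<tau>_mono: "\<tau> i \<le> \<tau> j" if "i \<le> j" "j \<le> Suc J" for i j
    using that by (induction j rule: dec_induct) (auto intro: order_trans \<tau>(2))
  have flow_dec: "\<Psi> (z b j) + k * b \<le> \<Psi> (z a j) + k * a"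
    if j: "j \<le> J" and ab: "\<tau> j \<le> a" "a \<le> b" "b \<le> \<tau> (Suc j)" for a b j
  proof (cases "a = b")
    case False
    then have "a < b" using ab by simp
    have "{a..b} \<times> {j} \<subseteq> {\<tau> j..\<tau> (Suc j)} \<times> {j}" using ab by auto
    then have arc': "{a..b} \<times> {j} \<subseteq> E \<inter> ({0..T} \<times> {0..J})" using arc[OF j] by (rule order_trans)
    then have sub: "{a..b} \<times> {j} \<subseteq> E" by simp
    have "(b, j) \<in> E \<inter> ({0..T} \<times> {0..J})" using ab by (intro subsetD[OF arc']) simp
    then have "b \<le> T" by simp
    note fl = hybrid_solution_flow[OF sol \<open>a < b\<close> sub]
    let ?K = "(\<lambda>t. z t j) ` {a..b}"
    have "compact ?K"
      using abs_continuous_on_imp_continuous_on[OF fl(1)] compact_continuous_image by blast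
    moreover have "?K \<subseteq> flow_set H" using fl(2) by blast
    ultimately obtain L where "L-lipschitz_on ?K \<Psi>" using lip by blast
    then have ac: "abs_continuous_on {a..b} (\<lambda>t. \<Psi> (z t j))"
      by (rule abs_continuous_on_lipschitz_compose[OF fl(1)])
    have "AE t in lebesgue. t \<in> {a<..<b} \<longrightarrow>
        (\<exists>m\<le>- k. ((\<lambda>t. \<Psi> (z t j)) has_real_derivative m) (at t))"
      using fl(3)
    proof (rule eventually_mono, intro impI)
      fix t assume ex: "t \<in> {a<..<b} \<longrightarrow>
          (\<exists>v\<in>flow_map H (z t j). ((\<lambda>s. z s j) has_vector_derivative v) (at t))"
        and t: "t \<in> {a<..<b}"
      then obtain v where v: "v \<in> flow_map H (z t j)"
        "((\<lambda>s. z s j) has_vector_derivative v) (at t)" by blast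
      have "\<forall>\<^sub>F s in nhds t. s \<in> {a<..<b}" using t by (intro eventually_nhds_in_open) auto
      then have near: "\<forall>\<^sub>F s in nhds t. z s j \<in> flow_set H"
        by eventually_elim (use fl(2) in auto)
      have "(t, j) \<in> E" using t by (intro subsetD[OF sub]) simp
      then have "z t j \<in> P" using P[of t j] t j \<open>b \<le> T\<close> by simp
      from flow[of "\<lambda>s. z s j", OF this near v]
      show "\<exists>m\<le>- k. ((\<lambda>t. \<Psi> (z t j)) has_real_derivative m) (at t)" .
    qed
    from abs_continuous_increment_le[OF ab(2) ac this] show ?thesis
      by (simp add: algebra_simps)
  qed simp
  have start: "(t0, j0) \<in> (\<Union>j\<le>J. {\<tau> j..\<tau> (Suc j)} \<times> {j})"
    using S htd unfolding eq[symmetric] hybrid_time_domain_def by auto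
  have "\<Psi> (z t j) + k * (t + real j) \<le> \<Psi> (z t0 j0) + k * (t0 + real j0)"
    if "j0 \<le> j" "j \<le> J" "\<tau> j \<le> t" "t \<le> \<tau> (Suc j)" "t0 \<le> t" for t j
    using that
  proof (induction j arbitrary: t rule: nat_induct_at_least)
    case base
    then show ?case using flow_dec[of j0 t0 t] start by (auto simp: algebra_simps)
  next
    case (Suc j)
    let ?s = "\<tau> (Suc j)"
    have j: "\<tau> j \<le> ?s" using \<tau>(2) Suc.prems by simp
    have "t0 \<le> \<tau> (Suc j0)" using start by auto
    also have "\<dots> \<le> ?s" using \<tau>_mono Suc.hyps Suc.prems by simp
    finally have "t0 \<le> ?s" .
    then have IH: "\<Psi> (z ?s j) + k * (?s + real j) \<le> \<Psi> (z t0 j0) + k * (t0 + real j0)"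
      using Suc.IH[of ?s] Suc.prems j by simp
    have "(?s, j) \<in> E \<inter> ({0..T} \<times> {0..J})"
      using j Suc.prems by (intro subsetD[OF arc[of j]]) auto
    moreover have "(?s, Suc j) \<in> E \<inter> ({0..T} \<times> {0..J})"
      using \<tau>(2)[of "Suc j"] Suc.prems by (intro subsetD[OF arc[of "Suc j"]]) auto
    ultimately have E: "(?s, j) \<in> E" "(?s, Suc j) \<in> E" "?s \<le> T" by auto
    have "\<Psi> (z ?s (Suc j)) \<le> \<Psi> (z ?s j) - k"
      using hybrid_solution_jump[OF sol E(1,2)] P[OF E(1) E(3)] Suc.prems
      by (intro jump) auto
    moreover have "\<Psi> (z t (Suc j)) + k * t \<le> \<Psi> (z ?s (Suc j)) + k * ?s"
      using Suc.prems by (intro flow_dec) auto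
    ultimately show ?case using IH by (simp add: algebra_simps)
  qed
  from this[of J T] show ?thesis using S \<tau> by auto
qed

section \<open>A criterion for uniform global asymptotic stability\<close>

text \<open>The bound \<open>\<beta> r s\<close> is the supremum of the distances attained at hybrid times from \<open>s\<close> on by solutions
that start within distance \<open>r\<close>. It is monotone in both arguments by construction; stability gives
finiteness and the limit at \<open>r = 0\<close>, attractivity the limit at \<open>s = \<infinity>\<close>. The element 0 keeps the
supremum meaningful when there are no such solutions.\<close>

lemma UGAS_if_stable_and_uniformly_attractive:
  fixes H :: "'z::euclidean_space hybrid_system"
  assumes K: "compact K"
    and mono: "\<And>r s. 0 \<le> r \<Longrightarrow> r \<le> s \<Longrightarrow> \<alpha> r \<le> \<alpha> s" and lim: "(\<alpha> \<longlongrightarrow> 0) (at_right 0)"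
    and stable: "\<And>E z t j. hybrid_solution H E z \<Longrightarrow> (t, j) \<in> E \<Longrightarrow>
      infdist (z t j) K \<le> \<alpha> (infdist (z 0 0) K)"
    and attractive: "\<And>r \<epsilon>. r \<ge> 0 \<Longrightarrow> \<epsilon> > 0 \<Longrightarrow> \<exists>S. \<forall>E z t j. hybrid_solution H E z \<longrightarrow>
      infdist (z 0 0) K \<le> r \<longrightarrow> (t, j) \<in> E \<longrightarrow> S \<le> t + real j \<longrightarrow> infdist (z t j) K \<le> \<epsilon>"
  shows "UGAS H K"
proof -
  define A where "A = (\<lambda>r s. insert 0 {d. \<exists>E z t j. hybrid_solution H E z \<and>
    infdist (z 0 0) K \<le> r \<and> (t, j) \<in> E \<and> s \<le> t + real j \<and> d = infdist (z t j) K})"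
  define \<beta> where "\<beta> = (\<lambda>r s. Sup (A r s))"
  have A_le: "d \<le> max 0 (\<alpha> r)" if d: "d \<in> A r s" for d r s
  proof (cases "d = 0")
    case False
    then obtain E z t j where *: "hybrid_solution H E z" "infdist (z 0 0) K \<le> r" "(t, j) \<in> E"
      "d = infdist (z t j) K" using d unfolding A_def by blast
    have "d \<le> \<alpha> (infdist (z 0 0) K)" using stable[OF *(1,3)] *(4) by simp
    also have "\<dots> \<le> \<alpha> r" using *(2) by (intro mono infdist_nonneg)
    finally show ?thesis by simp
  qed simp
  have bdd: "bdd_above (A r s)" for r s using A_le by (rule bdd_aboveI)
  have ne: "A r s \<noteq> {}" "0 \<in> A r s" for r s by (simp_all add: A_def)
  have nonneg: "0 \<le> \<beta> r s" for r s unfolding \<beta>_def by (rule cSup_upper[OF ne(2) bdd])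
  have upper: "\<beta> r s \<le> max 0 (\<alpha> r)" for r s unfolding \<beta>_def using A_le by (rule cSup_least[OF ne(1)])
  have subset: "\<beta> r s \<le> \<beta> r' s'" if "r \<le> r'" "s' \<le> s" for r s r' s'
    unfolding \<beta>_def
  proof (rule cSup_subset_mono[OF ne(1) bdd])
    show "A r s \<subseteq> A r' s'" unfolding A_def using that by (fastforce intro: order_trans)
  qed
  have "class_KL \<beta>"
    unfolding class_KL_def
  proof (intro conjI allI impI)
    show "0 \<le> \<beta> r s" for r s by (rule nonneg)
    show "mono_on {0..} (\<lambda>r. \<beta> r s)" for s by (intro mono_onI subset) auto
    show "antimono_on {0..} (\<beta> r)" for r by (intro monotone_onI subset) auto
    show "((\<lambda>r. \<beta> r s) \<longlongrightarrow> 0) (at_right 0)" for s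
    proof (rule tendsto_sandwich[of "\<lambda>_. 0" _ _ "\<lambda>r. max 0 (\<alpha> r)"])
      show "((\<lambda>r. max 0 (\<alpha> r)) \<longlongrightarrow> 0) (at_right 0)"
        using tendsto_max[OF tendsto_const[of 0] lim] by simp
    qed (use nonneg upper in auto)
    show "(\<beta> r \<longlongrightarrow> 0) at_top" if r: "0 \<le> r" for r
    proof (rule tendstoI)
      fix \<epsilon> :: real assume "\<epsilon> > 0"
      then have "\<epsilon> / 2 > 0" by simp
      from attractive[OF r this] obtain S where S: "\<forall>E z t j. hybrid_solution H E z \<longrightarrow>
        infdist (z 0 0) K \<le> r \<longrightarrow> (t, j) \<in> E \<longrightarrow> S \<le> t + real j \<longrightarrow> infdist (z t j) K \<le> \<epsilon> / 2"
        by blast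
      have "\<beta> r s \<le> \<epsilon> / 2" if "S \<le> s" for s
        unfolding \<beta>_def
      proof (rule cSup_least[OF ne(1)])
        fix d assume "d \<in> A r s"
        then show "d \<le> \<epsilon> / 2" using S that \<open>\<epsilon> / 2 > 0\<close> unfolding A_def by auto
      qed
      then have small: "dist (\<beta> r s) 0 < \<epsilon>" if "S \<le> s" for s
        using that nonneg[of r s] \<open>\<epsilon> > 0\<close> by (force simp: dist_real_def)
      then show "\<forall>\<^sub>F s in at_top. dist (\<beta> r s) 0 < \<epsilon>"
        unfolding eventually_at_top_linorder using small by blast
    qed
  qed
  moreover have "infdist (z t j) K \<le> \<beta> (infdist (z 0 0) K) (t + real j)"
    if "hybrid_solution H E z" "(t, j) \<in> E" for E z t j
    unfolding \<beta>_def by (rule cSup_upper[OF _ bdd]) (use that in \<open>auto simp: A_def\<close>)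
  ultimately show ?thesis using K unfolding UGAS_def by blast
qed

section \<open>The ideal closed loop of a synergistic family\<close>

lemma infdist_eq_dist:
  assumes "a \<in> A" "\<And>a'. a' \<in> A \<Longrightarrow> dist x a \<le> dist x a'"
  shows "infdist x A = dist x a"
proof (rule antisym)
  show "dist x a \<le> infdist x A"
    using assms by (subst infdist_notempty) (auto intro: cINF_greatest)
qed (rule infdist_le[OF assms(1)])

lemma nabla_ideal_field_driftless:
  assumes "drift S \<xi> = 0"
  shows "nabla (x_space S) W (fst \<xi>) \<bullet> ideal_field S W \<gamma> \<xi> =
    - \<gamma> * (\<Sum>i\<in>UNIV. (nabla (x_space S) W (fst \<xi>) \<bullet> ctrl S i \<xi>)\<^sup>2)"
  using assms by (simp add: ideal_field_def inner_sum_right power2_eq_square)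

locale synergistic_feedback =
  fixes M :: "(real ^ 'n) set"
    and p\<^sub>0 :: "real ^ 'n"
    and b :: "'r::finite \<Rightarrow> real ^ 'n \<Rightarrow> real ^ 'n"
    and V :: "real \<Rightarrow> real ^ 'n \<Rightarrow> real"
    and N :: nat
    and \<E> :: "(real ^ 'r) set"
    and lam \<delta> T\<^sub>0 \<chi>\<^sub>1 \<chi>\<^sub>2 :: real
  assumes manifold: "properly_embedded_manifold M" and p0: "p\<^sub>0 \<in> M"
    and b_C1: "\<And>i. C1_fun_on M (b i)"
    and b_tangent: "\<And>i p. p \<in> M \<Longrightarrow> b i p \<in> tangent_space M p"
    and lam: "lam > 0"
    and b_spans: "\<And>p v. p \<in> M \<Longrightarrow> v \<in> tangent_space M p \<Longrightarrow>
      (\<Sum>i\<in>UNIV. (b i p \<bullet> v)\<^sup>2) \<ge> lam * (v \<bullet> v)"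
    and family: "synergistic_family M p\<^sub>0 N V \<delta>"
    and finite_gains: "finite \<E>"
    and chi1: "\<chi>\<^sub>1 > 0" and chi2: "\<chi>\<^sub>2 < 1"
begin

abbreviation "X \<equiv> M \<times> modes N"
abbreviation "W \<equiv> (\<lambda>(p, q). V q p)"
abbreviation "sys \<equiv> synergistic_system M N V \<delta> b \<E> T\<^sub>0 \<chi>\<^sub>1 \<chi>\<^sub>2"
abbreviation "H \<equiv> ideal_closed_loop sys W 1"

lemma modes_finite_nonempty: "finite (modes N)" "modes N \<noteq> {}"
  using family by (auto simp: modes_def synergistic_family_def)

lemma V_properties:
  assumes "q \<in> modes N"
  shows "C1_fun_on M (V q)" "p \<in> M \<Longrightarrow> 0 \<le> V q p" "V q p\<^sub>0 = 0"
    "p \<in> M \<Longrightarrow> V q p = 0 \<longleftrightarrow> p = p\<^sub>0" "c \<ge> 0 \<Longrightarrow> compact {p \<in> M. V q p \<le> c}"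
proof -
  have *: "C1_fun_on M (V q) \<and> (\<forall>p\<in>M. 0 \<le> V q p) \<and> V q p\<^sub>0 = 0 \<and> (\<forall>p\<in>M - {p\<^sub>0}. 0 < V q p) \<and>
      (\<forall>c\<ge>0. compact {p \<in> M. V q p \<le> c})"
    using family assms unfolding synergistic_family_def by blast
  then show "C1_fun_on M (V q)" "p \<in> M \<Longrightarrow> 0 \<le> V q p" "V q p\<^sub>0 = 0"
    "c \<ge> 0 \<Longrightarrow> compact {p \<in> M. V q p \<le> c}" by auto
  assume "p \<in> M"
  then have "p \<noteq> p\<^sub>0 \<Longrightarrow> 0 < V q p" using * by blast
  then show "V q p = 0 \<longleftrightarrow> p = p\<^sub>0" using * by force
qed

lemma W_C1: "C1_fun_on X W"
  by (rule C1_fun_on_modes_product) (rule V_properties)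

lemma W_nonneg: "x \<in> X \<Longrightarrow> 0 \<le> W x"
  using V_properties(2) by auto

lemma delta_pos: "\<delta> > 0"
  using family by (simp add: synergistic_family_def)

lemma x_space: "x_space sys = X"
  by (auto simp: synergistic_system_def Let_def X_C_def X_D_def)

lemma gain_space: "gain_space sys = \<Theta>_C \<E> T\<^sub>0"
  by (auto simp: synergistic_system_def Let_def \<Theta>_C_def \<Theta>_D_def)

lemma flow_set: "flow_set H = X_C M N V \<delta> \<times> \<Theta>_C \<E> T\<^sub>0"
  by (simp add: ideal_closed_loop_def synergistic_system_def Let_def)

lemma flow_set_subset: "flow_set H \<subseteq> X \<times> \<Theta>_C \<E> T\<^sub>0"
  by (auto simp: flow_set X_C_def)

lemma jump_set_subset: "jump_set H \<subseteq> X \<times> \<Theta>_C \<E> T\<^sub>0"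
  by (auto simp: ideal_closed_loop_def synergistic_system_def Let_def X_C_def X_D_def
      \<Theta>_C_def \<Theta>_D_def)

lemma argmin_decrease:
  assumes x: "(p, q) \<in> X_D M N V \<delta>" and x': "x' \<in> G_X N V (p, q)"
  shows "x' \<in> X" "W x' \<le> W (p, q) - \<delta>"
proof -
  obtain q' where q': "x' = (p, q')" "q' \<in> modes N" "\<And>r. r \<in> modes N \<Longrightarrow> V q' p \<le> V r p"
    using x' by (fastforce simp: G_X_def is_arg_min_def not_less)
  then show "x' \<in> X" using x by (auto simp: X_D_def)
  have "V q' p \<le> Min ((\<lambda>q'. V q' p) ` modes N)"
    using modes_finite_nonempty q'(3) by (intro Min.boundedI) auto
  then show "W x' \<le> W (p, q) - \<delta>" using x q'(1) by (simp add: X_D_def synergy_gap_def)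
qed

text \<open>The dichotomy behind the decrease at jumps: a jump either switches the mode and pays \<open>\<delta>\<close> in \<open>W\<close>, or
only switches the gains and resets the clock \<open>\<theta>\<^bsub>r+1\<^esub>\<close> from 1 to 0.\<close>

lemma jump_cases:
  assumes \<xi>: "\<xi> \<in> jump_set H" and \<xi>': "\<xi>' \<in> jump_map H \<xi>"
  shows "\<xi>' \<in> X \<times> \<Theta>_C \<E> T\<^sub>0" and "snd (snd (snd \<xi>')) = snd (snd (snd \<xi>))"
    and "(W (fst \<xi>') \<le> W (fst \<xi>) - \<delta> \<and> fst (snd (snd \<xi>')) \<le> fst (snd (snd \<xi>))) \<or>
      (fst \<xi>' = fst \<xi> \<and> fst (snd (snd \<xi>')) = fst (snd (snd \<xi>)) - 1)"
proof -
  obtain p q e s \<tau> where x: "\<xi> = ((p, q), e, s, \<tau>)" by (metis prod.exhaust)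
  obtain x' e' s' \<tau>' where x': "\<xi>' = (x', e', s', \<tau>')" by (metis prod.exhaust)
  have inX: "(p, q) \<in> X" "(e, s, \<tau>) \<in> \<Theta>_C \<E> T\<^sub>0" using \<xi> jump_set_subset x by auto
  consider "(p, q) \<in> X_D M N V \<delta>" "(e, s, \<tau>) \<in> \<Theta>_D \<E> T\<^sub>0"
      "x' \<in> G_X N V (p, q)" "(e', s', \<tau>') \<in> G_e \<E> (e, s, \<tau>)"
    | "(e, s, \<tau>) \<in> \<Theta>_D \<E> T\<^sub>0" "x' = (p, q)" "(e', s', \<tau>') \<in> G_e \<E> (e, s, \<tau>)"
    | "(p, q) \<in> X_D M N V \<delta>" "x' \<in> G_X N V (p, q)" "(e', s', \<tau>') = (e, s, \<tau>)"
    using \<xi>' unfolding x x' ideal_closed_loop_def synergistic_system_def Let_def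
    by (auto split: if_splits)
  then have "x' \<in> X \<and> (e', s', \<tau>') \<in> \<Theta>_C \<E> T\<^sub>0 \<and> \<tau>' = \<tau> \<and>
    ((W x' \<le> W (p, q) - \<delta> \<and> s' \<le> s) \<or> (x' = (p, q) \<and> s' = s - 1))"
  proof cases
    case 1
    then show ?thesis using argmin_decrease[OF 1(1,3)] by (auto simp: G_e_def \<Theta>_C_def \<Theta>_D_def)
  next
    case 2
    then show ?thesis using inX by (auto simp: G_e_def \<Theta>_C_def \<Theta>_D_def)
  next
    case 3
    then show ?thesis using argmin_decrease[OF 3(1,2)] inX by auto
  qed
  then show "\<xi>' \<in> X \<times> \<Theta>_C \<E> T\<^sub>0" "snd (snd (snd \<xi>')) = snd (snd (snd \<xi>))"
    "(W (fst \<xi>') \<le> W (fst \<xi>) - \<delta> \<and> fst (snd (snd \<xi>')) \<le> fst (snd (snd \<xi>))) \<or>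
      (fst \<xi>' = fst \<xi> \<and> fst (snd (snd \<xi>')) = fst (snd (snd \<xi>)) - 1)"
    by (auto simp: x x')
qed

lemma solution_viable:
  assumes "hybrid_solution H E z" "(t, j) \<in> E"
  shows "z t j \<in> X \<times> \<Theta>_C \<E> T\<^sub>0"
proof (rule hybrid_solution_viable[OF assms(1) _ _ assms(2)])
  show "flow_set H \<union> jump_set H \<subseteq> X \<times> \<Theta>_C \<E> T\<^sub>0"
    using flow_set_subset jump_set_subset by blast
  show "jump_map H \<xi> \<subseteq> X \<times> \<Theta>_C \<E> T\<^sub>0" if "\<xi> \<in> jump_set H" for \<xi>
    using jump_cases(1)[OF that] by blast
qed

lemma nabla_ctrl:
  assumes "(p, q) \<in> X"
  shows "nabla X W (p, q) \<bullet> ctrl sys i ((p, q), \<theta>) = fst \<theta> $ i * (nabla M (V q) p \<bullet> b i p)"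
proof -
  have "nabla X W (p, q) \<bullet> (b i p, 0) = nabla M (V q) p \<bullet> b i p"
    using nabla_product_eq[OF W_C1, of q "b i p" p] V_properties(1)[of q] b_tangent[of p i] assms
    by simp
  moreover have "ctrl sys i ((p, q), \<theta>) = (fst \<theta> $ i) *\<^sub>R (b i p, 0)"
    by (simp add: synergistic_system_def Let_def)
  ultimately show ?thesis by (simp only: inner_scaleR_right)
qed

lemma nabla_ideal_field:
  assumes "(p, q) \<in> X"
  shows "nabla X W (p, q) \<bullet> ideal_field sys W 1 ((p, q), \<theta>) =
    - (\<Sum>i\<in>UNIV. (fst \<theta> $ i)\<^sup>2 * (nabla M (V q) p \<bullet> b i p)\<^sup>2)"
proof -
  have "drift sys ((p, q), \<theta>) = 0" by (simp add: synergistic_system_def Let_def)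
  from nabla_ideal_field_driftless[OF this, of W 1] show ?thesis
    using assms by (simp add: x_space nabla_ctrl power_mult_distrib)
qed

text \<open>The condition that the synergy gap is at most \<open>\<delta>\<close> is closed and excludes all critical points other
than \<open>p\<^sub>0\<close>, while \<open>\<epsilon> \<le> V q p\<close> excludes \<open>p\<^sub>0\<close>. So the sum is continuous and positive on a compact set.\<close>

lemma gradient_bounded_below:
  assumes \<epsilon>: "\<epsilon> > 0" and c: "c \<ge> 0"
  shows "\<exists>\<kappa>>0. \<forall>(p, q)\<in>X_C M N V \<delta>. \<epsilon> \<le> V q p \<longrightarrow> V q p \<le> c \<longrightarrow>
    \<kappa> \<le> (\<Sum>i\<in>UNIV. (nabla M (V q) p \<bullet> b i p)\<^sup>2)"
proof -
  let ?D = "\<lambda>q p. \<Sum>i\<in>UNIV. (nabla M (V q) p \<bullet> b i p)\<^sup>2"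
  have "\<exists>\<kappa>>0. \<forall>p\<in>M. \<epsilon> \<le> V q p \<longrightarrow> V q p \<le> c \<longrightarrow> (\<forall>r\<in>modes N. V q p \<le> V r p + \<delta>) \<longrightarrow> \<kappa> \<le> ?D q p"
    if q: "q \<in> modes N" for q
  proof -
    let ?S = "{p \<in> M. V q p \<le> c}"
    let ?K = "?S \<inter> {p \<in> ?S. \<epsilon> \<le> V q p} \<inter> (\<Inter>r\<in>modes N. {p \<in> ?S. V q p \<le> V r p + \<delta>})"
    have S: "compact ?S" by (rule V_properties(5)[OF q c])
    have cont: "continuous_on ?S (V r)" if "r \<in> modes N" for r
      by (rule continuous_on_subset[OF C1_fun_on_continuous_on[OF V_properties(1)[OF that]]]) auto
    have K: "compact ?K"
      using q modes_finite_nonempty S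
      by (intro compact_Int_closed closed_INT ballI continuous_on_closed_Collect_le
          continuous_intros cont compact_imp_closed[OF S]) auto
    have pos: "?D q p > 0" if p: "p \<in> ?K" for p
    proof (rule ccontr)
      assume "\<not> ?D q p > 0"
      moreover have "?D q p \<ge> 0" by (intro sum_nonneg) auto
      ultimately have "?D q p = 0" by simp
      then have zero: "nabla M (V q) p \<bullet> b i p = 0" for i
        by (subst (asm) sum_nonneg_eq_0_iff) auto
      have pM: "p \<in> M" using p by simp
      have sub: "subspace (tangent_space M p)"
        using manifold subspace_tangent_space pM unfolding properly_embedded_manifold_def by blast
      have "p \<in> Crit M (V q)"
        by (rule Crit_if_nabla_orthogonal_spanning_fields[where b = b and lam = lam, OF sub pM b_tangent[OF pM] lam
              b_spans[OF pM] zero])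
      moreover have "p \<noteq> p\<^sub>0" using p \<epsilon> V_properties(3)[OF q] by auto
      ultimately have "gap_bound M p\<^sub>0 N V \<le> ereal (synergy_gap N V (p, q))"
        unfolding gap_bound_def using q by (intro INF_lower2[of "(p, q)"]) auto
      moreover have "ereal \<delta> < gap_bound M p\<^sub>0 N V" using family by (simp add: synergistic_family_def)
      ultimately have "\<delta> < synergy_gap N V (p, q)" by (meson ereal_less_eq(3) not_le order_trans)
      moreover have "V q p - \<delta> \<le> Min ((\<lambda>q'. V q' p) ` modes N)"
        using modes_finite_nonempty p by (intro Min.boundedI) (auto simp: algebra_simps)
      ultimately show False by (simp add: synergy_gap_def)
    qed
    have contD: "continuous_on ?K (?D q)"
    proof (rule continuous_on_subset)
      show "continuous_on M (?D q)"
        by (intro continuous_intros continuous_on_nabla_inner V_properties(1)[OF q]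
            C1_fun_on_continuous_on b_C1 b_tangent)
    qed auto
    show ?thesis
    proof (cases "?K = {}")
      case True
      then show ?thesis by (intro exI[of _ 1]) auto
    next
      case False
      from continuous_attains_inf[OF K False contD] obtain y where
        "y \<in> ?K" "\<forall>p\<in>?K. ?D q y \<le> ?D q p" by blast
      then show ?thesis using pos by (intro exI[of _ "?D q y"]) auto
    qed
  qed
  then obtain \<kappa> where \<kappa>: "\<forall>q\<in>modes N. \<kappa> q > 0 \<and> (\<forall>p\<in>M. \<epsilon> \<le> V q p \<longrightarrow> V q p \<le> c \<longrightarrow>
      (\<forall>r\<in>modes N. V q p \<le> V r p + \<delta>) \<longrightarrow> \<kappa> q \<le> ?D q p)"
    by metis
  have "Min (\<kappa> ` modes N) > 0" using modes_finite_nonempty \<kappa> by simp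
  moreover have "Min (\<kappa> ` modes N) \<le> ?D q p"
    if x: "(p, q) \<in> X_C M N V \<delta>" "\<epsilon> \<le> V q p" "V q p \<le> c" for p q
  proof -
    have pq: "p \<in> M" "q \<in> modes N" "synergy_gap N V (p, q) \<le> \<delta>" using x(1) by (auto simp: X_C_def)
    have "V q p \<le> V r p + \<delta>" if "r \<in> modes N" for r
    proof -
      have "Min ((\<lambda>q'. V q' p) ` modes N) \<le> V r p" using modes_finite_nonempty that by (intro Min_le) auto
      then show ?thesis using pq(3) by (simp add: synergy_gap_def)
    qed
    then have "\<kappa> q \<le> ?D q p" using \<kappa> pq x by blast
    moreover have "Min (\<kappa> ` modes N) \<le> \<kappa> q" using modes_finite_nonempty pq by simp
    ultimately show ?thesis by simp
  qed
  ultimately show ?thesis by (intro exI[of _ "Min (\<kappa> ` modes N)"]) auto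
qed

lemma nonzero_gains_bounded_below:
  "\<exists>\<rho>>0. \<forall>e\<in>\<E>. \<forall>i. e $ i \<noteq> 0 \<longrightarrow> \<rho> \<le> (e $ i)\<^sup>2"
proof -
  let ?S = "insert 1 ((\<lambda>(e, i). (e $ i)\<^sup>2) ` {(e, i) \<in> \<E> \<times> UNIV. e $ i \<noteq> 0})"
  have "finite {(e, i) \<in> \<E> \<times> UNIV. e $ i \<noteq> 0}"
    by (rule finite_subset[of _ "\<E> \<times> UNIV"]) (use finite_gains in auto)
  then have fin: "finite ?S" by (intro finite.insertI finite_imageI)
  have "Min ?S > 0" using fin by (subst Min_gr_iff) auto
  moreover have "Min ?S \<le> (e $ i)\<^sup>2" if "e \<in> \<E>" "e $ i \<noteq> 0" for e i
    using that by (intro Min_le[OF fin]) force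
  ultimately show ?thesis by blast
qed

text \<open>The state components paired with the coefficients are \<open>W\<close>, the dwell clock \<open>\<theta>\<^bsub>r+2\<^esub>\<close> and the switching
clock \<open>\<theta>\<^bsub>r+1\<^esub>\<close>. The coefficients \<open>1, 0, 0\<close> give \<open>W\<close>; positive ones give a strict Lyapunov function.\<close>

definition \<Phi> where "\<Phi> A B C = (\<lambda>\<xi>. A * W (fst \<xi>) + B * snd (snd (snd \<xi>)) + C * fst (snd (snd \<xi>)))"

lemma \<Phi>_lipschitz:
  assumes K: "compact K" "K \<subseteq> flow_set H"
  shows "\<exists>L. L-lipschitz_on K (\<Phi> A B C)"
proof -
  have "compact (fst ` K)" by (rule compact_continuous_image[OF _ K(1)]) (intro continuous_intros)
  moreover have "fst ` K \<subseteq> X" using K(2) flow_set_subset by auto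
  ultimately obtain L where "L-lipschitz_on (fst ` K) W"
    using C1_fun_on_lipschitz_on_compact[OF W_C1] by blast
  moreover have fs: "1-lipschitz_on S fst" "1-lipschitz_on S snd"
    for S :: "('x::metric_space \<times> 'y::metric_space) set"
    by (rule lipschitz_onI; simp add: dist_fst_le dist_snd_le)+
  ultimately have 1: "(L * 1)-lipschitz_on K (\<lambda>\<xi>. W (fst \<xi>))"
    using lipschitz_on_compose2 by blast
  have 2: "(1 * (1 * 1))-lipschitz_on K (\<lambda>\<xi>. snd (snd (snd \<xi>)))"
    "(1 * (1 * 1))-lipschitz_on K (\<lambda>\<xi>. fst (snd (snd \<xi>)))"
    by (intro lipschitz_on_compose2[where g = snd] lipschitz_on_compose2[where g = fst] fs)+
  show ?thesis
    unfolding \<Phi>_def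
    using lipschitz_on_add[OF lipschitz_on_add[OF lipschitz_on_cmult_real[OF 1, of A]
        lipschitz_on_cmult_real[OF 2(1), of B]] lipschitz_on_cmult_real[OF 2(2), of C]]
    by blast
qed

lemma \<Phi>_derivative:
  assumes near: "\<forall>\<^sub>F s in nhds t. c s \<in> flow_set H" and v: "v \<in> flow_map H (c t)"
    and c: "(c has_vector_derivative v) (at t)" and ct: "c t = ((p, q), \<theta>)"
  shows "((\<lambda>s. \<Phi> A B C (c s)) has_real_derivative
     A * - (\<Sum>i\<in>UNIV. (fst \<theta> $ i)\<^sup>2 * (nabla M (V q) p \<bullet> b i p)\<^sup>2)
      + B * snd (snd (snd v)) + C * fst (snd (snd v))) (at t)"
    and "snd v \<in> F_e \<chi>\<^sub>1 \<chi>\<^sub>2 \<theta>"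
proof -
  have v': "fst v = ideal_field sys W 1 (c t)" "snd v \<in> F_e \<chi>\<^sub>1 \<chi>\<^sub>2 \<theta>"
    using v ct by (auto simp: ideal_closed_loop_def synergistic_system_def Let_def)
  show "snd v \<in> F_e \<chi>\<^sub>1 \<chi>\<^sub>2 \<theta>" by fact
  have X: "(p, q) \<in> X" using eventually_nhds_x_imp_x[OF near] flow_set_subset ct by auto
  have nearX: "\<forall>\<^sub>F s in nhds t. fst (c s) \<in> X"
    using near by eventually_elim (use flow_set_subset in auto)
  have fst': "((\<lambda>s. fst (c s)) has_vector_derivative fst v) (at t)"
    by (rule bounded_linear.has_vector_derivative[OF bounded_linear_fst c])
  have W': "((\<lambda>s. W (fst (c s))) has_real_derivative
      - (\<Sum>i\<in>UNIV. (fst \<theta> $ i)\<^sup>2 * (nabla M (V q) p \<bullet> b i p)\<^sup>2)) (at t)"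
    using nabla_along_curve[OF W_C1 fst' nearX] nabla_ideal_field[OF X, of \<theta>] ct
    by (simp add: v')
  have snd': "((\<lambda>s. snd (snd (c s))) has_vector_derivative snd (snd v)) (at t)"
    by (intro bounded_linear.has_vector_derivative[OF bounded_linear_snd] c)
  have "((\<lambda>s. snd (snd (snd (c s)))) has_real_derivative snd (snd (snd v))) (at t)"
    "((\<lambda>s. fst (snd (snd (c s)))) has_real_derivative fst (snd (snd v))) (at t)"
    unfolding has_real_derivative_iff_has_vector_derivative
    using bounded_linear.has_vector_derivative[OF bounded_linear_snd snd']
      bounded_linear.has_vector_derivative[OF bounded_linear_fst snd'] by auto
  then show "((\<lambda>s. \<Phi> A B C (c s)) has_real_derivative
     A * - (\<Sum>i\<in>UNIV. (fst \<theta> $ i)\<^sup>2 * (nabla M (V q) p \<bullet> b i p)\<^sup>2)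
      + B * snd (snd (snd v)) + C * fst (snd (snd v))) (at t)"
    unfolding \<Phi>_def by (intro DERIV_add DERIV_cmult W')
qed

lemma W_nonincreasing:
  assumes sol: "hybrid_solution H E z" and "(T, J) \<in> E" "(t, j) \<in> E" "t \<le> T" "j \<le> J"
  shows "W (fst (z T J)) \<le> W (fst (z t j))"
proof -
  have "\<Phi> 1 0 0 (z T J) + 0 * (T + real J) \<le> \<Phi> 1 0 0 (z t j) + 0 * (t + real j)"
  proof (rule hybrid_solution_decrease[OF sol \<Phi>_lipschitz, where P = UNIV])
    show "\<exists>m\<le>- 0. ((\<lambda>s. \<Phi> 1 0 0 (c s)) has_real_derivative m) (at t)"
      if "\<forall>\<^sub>F s in nhds t. c s \<in> flow_set H" "v \<in> flow_map H (c t)"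
        "(c has_vector_derivative v) (at t)" for c v t
    proof -
      obtain p q \<theta> where ct: "c t = ((p, q), \<theta>)" by (metis prod.exhaust)
      have "0 \<le> (\<Sum>i\<in>UNIV. (fst \<theta> $ i)\<^sup>2 * (nabla M (V q) p \<bullet> b i p)\<^sup>2)"
        by (intro sum_nonneg) auto
      then show ?thesis using \<Phi>_derivative(1)[OF that ct, of 1 0 0] by (intro exI conjI) auto
    qed
    show "\<Phi> 1 0 0 \<xi>' \<le> \<Phi> 1 0 0 \<xi> - 0" if "\<xi> \<in> jump_set H" "\<xi>' \<in> jump_map H \<xi>" for \<xi> \<xi>'
      using jump_cases(3)[OF that] delta_pos by (auto simp: \<Phi>_def)
  qed (use assms in auto)
  then show ?thesis by (simp add: \<Phi>_def)
qed

text \<open>The time needed to reach \<open>W < \<epsilon>\<close> is bounded because \<open>\<Phi> A B 1\<close> loses at least one unit per unit of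
hybrid time as long as \<open>\<epsilon> \<le> W\<close>.\<close>

lemma uniform_decay_time:
  assumes \<epsilon>: "\<epsilon> > 0" and c: "c \<ge> 0"
  shows "\<exists>S. \<forall>E z T J. hybrid_solution H E z \<longrightarrow> W (fst (z 0 0)) \<le> c \<longrightarrow> (T, J) \<in> E \<longrightarrow>
    S < T + real J \<longrightarrow> W (fst (z T J)) < \<epsilon>"
proof -
  obtain \<kappa> where \<kappa>: "\<kappa> > 0" "\<forall>(p, q)\<in>X_C M N V \<delta>. \<epsilon> \<le> V q p \<longrightarrow> V q p \<le> c \<longrightarrow>
      \<kappa> \<le> (\<Sum>i\<in>UNIV. (nabla M (V q) p \<bullet> b i p)\<^sup>2)"
    using gradient_bounded_below[OF \<epsilon> c] by blast
  obtain \<rho> where \<rho>: "\<rho> > 0" "\<forall>e\<in>\<E>. \<forall>i. e $ i \<noteq> 0 \<longrightarrow> \<rho> \<le> (e $ i)\<^sup>2"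
    using nonzero_gains_bounded_below by blast
  \<comment> \<open>\<open>B\<close> compensates the growth of the switching clock while a gain vanishes; \<open>A\<close> compensates the growth
    of both clocks otherwise, and turns a loss of \<open>\<delta>\<close> in \<open>W\<close> into a loss of 1.\<close>
  define B where "B = (1 + \<chi>\<^sub>1) / (1 - \<chi>\<^sub>2)"
  define A where "A = max (1 / \<delta>) ((1 + \<chi>\<^sub>1 + B * \<chi>\<^sub>2) / (\<rho> * \<kappa>))"
  have B: "B > 0" "B * (1 - \<chi>\<^sub>2) = 1 + \<chi>\<^sub>1" using chi1 chi2 by (auto simp: B_def)
  have "A \<ge> 1 / \<delta>" "A \<ge> (1 + \<chi>\<^sub>1 + B * \<chi>\<^sub>2) / (\<rho> * \<kappa>)" by (auto simp: A_def)
  then have A: "A * \<delta> \<ge> 1" "A * (\<rho> * \<kappa>) \<ge> 1 + \<chi>\<^sub>1 + B * \<chi>\<^sub>2"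
    using delta_pos \<rho>(1) \<kappa>(1) by (simp_all add: pos_divide_le_eq)
  have "1 / \<delta> > 0" using delta_pos by simp
  then have A0: "A > 0" using \<open>A \<ge> 1 / \<delta>\<close> by linarith
  have "W (fst (z T J)) < \<epsilon>" if sol: "hybrid_solution H E z" and z0: "W (fst (z 0 0)) \<le> c"
    and TJ: "(T, J) \<in> E" and long: "A * c + B * T\<^sub>0 + 1 < T + real J" for E z T J
  proof (rule ccontr)
    assume "\<not> ?thesis"
    then have zT: "\<epsilon> \<le> W (fst (z T J))" by simp
    let ?P = "{\<xi>. \<epsilon> \<le> W (fst \<xi>) \<and> W (fst \<xi>) \<le> c}"
    have htd: "(0, 0) \<in> E" "E \<subseteq> {0..} \<times> UNIV"
      using sol by (auto simp: hybrid_solution_def hybrid_time_domain_def)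
    have nonneg: "0 \<le> t" if "(t, j) \<in> E" for t j using htd(2) that by auto
    have "\<Phi> A B 1 (z T J) + 1 * (T + real J) \<le> \<Phi> A B 1 (z 0 0) + 1 * (0 + real 0)"
    proof (rule hybrid_solution_decrease[OF sol \<Phi>_lipschitz, where P = ?P])
      show "z t j \<in> ?P" if "(t, j) \<in> E" "t \<le> T" "j \<le> J" for t j
        using W_nonincreasing[OF sol TJ that(1,2,3)] W_nonincreasing[OF sol that(1) htd(1)]
          nonneg[OF that(1)] zT z0 by simp
      show "\<Phi> A B 1 \<xi>' \<le> \<Phi> A B 1 \<xi> - 1" if "\<xi> \<in> jump_set H" "\<xi>' \<in> jump_map H \<xi>" for \<xi> \<xi>'
        using jump_cases(3)[OF that]
      proof
        assume *: "W (fst \<xi>') \<le> W (fst \<xi>) - \<delta> \<and> fst (snd (snd \<xi>')) \<le> fst (snd (snd \<xi>))"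
        then have "A * W (fst \<xi>') \<le> A * (W (fst \<xi>) - \<delta>)" using A0 by (intro mult_left_mono) auto
        then show ?thesis using * A(1) jump_cases(2)[OF that] by (simp add: \<Phi>_def right_diff_distrib)
      qed (simp add: \<Phi>_def jump_cases(2)[OF that])
      show "\<exists>m\<le>- 1. ((\<lambda>s. \<Phi> A B 1 (c s)) has_real_derivative m) (at t)"
        if P: "c t \<in> ?P" and near: "\<forall>\<^sub>F s in nhds t. c s \<in> flow_set H"
          and v: "v \<in> flow_map H (c t)" "(c has_vector_derivative v) (at t)" for c v t
      proof -
        obtain p q e s \<tau> where ct: "c t = ((p, q), e, s, \<tau>)" by (metis prod.exhaust)
        let ?d = "\<Sum>i\<in>UNIV. (e $ i)\<^sup>2 * (nabla M (V q) p \<bullet> b i p)\<^sup>2"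
        note der = \<Phi>_derivative[OF near v ct]
        have in_flow: "(p, q) \<in> X_C M N V \<delta>" "e \<in> \<E>"
          using eventually_nhds_x_imp_x[OF near] ct by (auto simp: flow_set \<Theta>_C_def)
        have s': "fst (snd (snd v)) \<le> \<chi>\<^sub>1" using der(2) by (auto simp: F_e_def)
        have "A * - ?d + B * snd (snd (snd v)) + 1 * fst (snd (snd v)) \<le> - 1"
        proof (cases "(e, s, \<tau>) \<in> zero_gains")
          case True
          then have "snd (snd (snd v)) \<le> \<chi>\<^sub>2 - 1" using der(2) by (auto simp: F_e_def)
          then have "B * snd (snd (snd v)) \<le> B * (\<chi>\<^sub>2 - 1)" using B(1) by (intro mult_left_mono) auto
          moreover have "0 \<le> A * ?d" using A0 by (intro mult_nonneg_nonneg sum_nonneg) auto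
          ultimately show ?thesis using s' B(2) by (simp add: algebra_simps)
        next
          case False
          then have "\<And>i. e $ i \<noteq> 0" by (simp add: zero_gains_def)
          then have \<rho>e: "\<rho> \<le> (e $ i)\<^sup>2" for i using \<rho>(2) in_flow(2) by blast
          have "\<rho> * \<kappa> \<le> \<rho> * (\<Sum>i\<in>UNIV. (nabla M (V q) p \<bullet> b i p)\<^sup>2)"
            using \<kappa>(2) in_flow(1) P ct \<rho>(1) by (intro mult_left_mono) auto
          also have "\<dots> \<le> ?d"
            unfolding sum_distrib_left using \<rho>e by (intro sum_mono mult_right_mono) auto
          finally have "A * (\<rho> * \<kappa>) \<le> A * ?d" using A0 by (intro mult_left_mono) auto
          moreover have "snd (snd (snd v)) \<le> \<chi>\<^sub>2" using der(2) False by (auto simp: F_e_def)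
          then have "B * snd (snd (snd v)) \<le> B * \<chi>\<^sub>2" using B(1) by (intro mult_left_mono) auto
          ultimately show ?thesis using s' A(2) by simp
        qed
        then show ?thesis using der(1)[of A B 1] by (intro exI conjI) auto
      qed
    qed (use TJ htd nonneg in auto)
    moreover have "0 \<le> \<Phi> A B 1 (z T J)"
      using solution_viable[OF sol TJ] W_nonneg[of "fst (z T J)"] A0 B(1)
      by (auto simp: \<Phi>_def \<Theta>_C_def)
    moreover have "\<Phi> A B 1 (z 0 0) \<le> A * c + B * T\<^sub>0 + 1"
      unfolding \<Phi>_def
      using solution_viable[OF sol htd(1)] z0 A0 B(1)
      by (intro add_mono mult_left_mono) (auto simp: \<Theta>_C_def)
    ultimately show False using long by simp
  qed
  then show ?thesis by blast
qed

abbreviation "target \<equiv> {p\<^sub>0} \<times> modes N"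

lemma infdist_target:
  assumes "x \<in> X"
  shows "infdist x target = dist (fst x) p\<^sub>0"
proof -
  have "infdist x target = dist x (p\<^sub>0, snd x)"
  proof (rule infdist_eq_dist)
    show "(p\<^sub>0, snd x) \<in> target" using assms by auto
    show "dist x (p\<^sub>0, snd x) \<le> dist x a" if "a \<in> target" for a
      using that dist_fst_le[of x a] by (auto simp: dist_prod_def)
  qed
  then show ?thesis by (simp add: dist_prod_def)
qed

lemma infdist_target_gains:
  assumes "\<xi> \<in> X \<times> \<Theta>_C \<E> T\<^sub>0"
  shows "infdist \<xi> (target \<times> \<Theta>_C \<E> T\<^sub>0) = dist (fst (fst \<xi>)) p\<^sub>0"
proof -
  have "infdist \<xi> (target \<times> \<Theta>_C \<E> T\<^sub>0) = dist \<xi> ((p\<^sub>0, snd (fst \<xi>)), snd \<xi>)"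
  proof (rule infdist_eq_dist)
    show "((p\<^sub>0, snd (fst \<xi>)), snd \<xi>) \<in> target \<times> \<Theta>_C \<E> T\<^sub>0" using assms by auto
    fix a assume "a \<in> target \<times> \<Theta>_C \<E> T\<^sub>0"
    then have "dist (fst (fst \<xi>)) p\<^sub>0 \<le> dist \<xi> a"
      using dist_fst_le[of "fst \<xi>" "fst a"] dist_fst_le[of \<xi> a] by auto
    then show "dist \<xi> ((p\<^sub>0, snd (fst \<xi>)), snd \<xi>) \<le> dist \<xi> a"
      by (simp add: dist_prod_def[of \<xi> "((p\<^sub>0, snd (fst \<xi>)), snd \<xi>)"] dist_prod_def[of "fst \<xi>" "(p\<^sub>0, snd (fst \<xi>))"])
  qed
  then show ?thesis by (simp add: dist_prod_def)
qed

lemma W_sublevel_compact: "compact {x \<in> X. W x \<le> c}"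
proof (cases "c \<ge> 0")
  case True
  have "{x \<in> X. W x \<le> c} = (\<Union>q\<in>modes N. {p \<in> M. V q p \<le> c} \<times> {q})" by auto
  then show ?thesis
    using modes_finite_nonempty(1) V_properties(5) True by (auto intro!: compact_UN compact_Times)
next
  case False
  then have empty: "{x \<in> X. W x \<le> c} = {}" using W_nonneg by force
  show ?thesis unfolding empty by (rule compact_empty)
qed

lemma W_upper_bound:
  "\<exists>\<alpha>. class_K_inf \<alpha> \<and> (\<forall>x\<in>X. W x \<le> \<alpha> (dist (fst x) p\<^sub>0))"
proof (rule class_K_inf_majorant_proper)
  show "continuous_on X W" by (rule C1_fun_on_continuous_on[OF W_C1])
  show "continuous_on X (\<lambda>x. dist (fst x) p\<^sub>0)" by (intro continuous_intros)
  show "compact {x \<in> X. dist (fst x) p\<^sub>0 \<le> r}" for r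
  proof -
    have "{x \<in> X. dist (fst x) p\<^sub>0 \<le> r} = (cball p\<^sub>0 r \<inter> M) \<times> modes N"
      by (auto simp: dist_commute)
    moreover have "compact (cball p\<^sub>0 r \<inter> M)"
      using manifold by (intro compact_Int_closed compact_cball) (simp add: properly_embedded_manifold_def)
    ultimately show ?thesis using modes_finite_nonempty(1) by (simp add: compact_Times finite_imp_compact)
  qed
  show "W x \<le> 0" if "x \<in> X" "dist (fst x) p\<^sub>0 = 0" for x
    using that V_properties(3) by auto
qed auto

lemma W_lower_bound:
  "\<exists>\<eta>. class_K_inf \<eta> \<and> (\<forall>x\<in>X. dist (fst x) p\<^sub>0 \<le> \<eta> (W x))"
proof (rule class_K_inf_majorant_proper)
  show "continuous_on X W" by (rule C1_fun_on_continuous_on[OF W_C1])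
  show "continuous_on X (\<lambda>x. dist (fst x) p\<^sub>0)" by (intro continuous_intros)
  show "dist (fst x) p\<^sub>0 \<le> 0" if "x \<in> X" "W x = 0" for x
    using that V_properties(4) by auto
qed (rule W_nonneg W_sublevel_compact, assumption?)+

lemma W_sclf_candidate: "sclf_candidate sys W target 1"
  unfolding sclf_candidate_def
proof (intro conjI)
  show "compact target" using modes_finite_nonempty(1) by (simp add: finite_imp_compact)
  show "C1_fun_on (x_space sys) W" unfolding x_space by (rule W_C1)
  obtain \<alpha>\<^sub>2 where \<alpha>\<^sub>2: "class_K_inf \<alpha>\<^sub>2" "\<forall>x\<in>X. W x \<le> \<alpha>\<^sub>2 (dist (fst x) p\<^sub>0)"
    using W_upper_bound by blast
  obtain \<eta> where \<eta>: "class_K_inf \<eta>" "\<forall>x\<in>X. dist (fst x) p\<^sub>0 \<le> \<eta> (W x)"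
    using W_lower_bound by blast
  obtain \<alpha>\<^sub>1 where \<alpha>\<^sub>1: "class_K_inf \<alpha>\<^sub>1" "\<forall>r\<ge>0. \<forall>s\<ge>0. r \<le> \<eta> s \<longrightarrow> \<alpha>\<^sub>1 r \<le> s"
    using class_K_inf_inverse[OF \<eta>(1)] by blast
  have lower: "\<alpha>\<^sub>1 (infdist x target) \<le> W x" if x: "x \<in> X" for x
  proof -
    have "dist (fst x) p\<^sub>0 \<le> \<eta> (W x)" using \<eta>(2) x by (rule bspec)
    then show ?thesis unfolding infdist_target[OF x] using \<alpha>\<^sub>1(2) W_nonneg[OF x] by simp
  qed
  have upper: "W x \<le> \<alpha>\<^sub>2 (infdist x target)" if x: "x \<in> X" for x
    unfolding infdist_target[OF x] using \<alpha>\<^sub>2(2) x by (rule bspec)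
  show "\<exists>\<alpha>\<^sub>1 \<alpha>\<^sub>2. class_K_inf \<alpha>\<^sub>1 \<and> class_K_inf \<alpha>\<^sub>2 \<and> (\<forall>x\<in>x_space sys.
      \<alpha>\<^sub>1 (infdist x target) \<le> W x \<and> W x \<le> \<alpha>\<^sub>2 (infdist x target))"
    unfolding x_space
    by (intro exI[of _ \<alpha>\<^sub>1] exI[of _ \<alpha>\<^sub>2] conjI ballI \<alpha>\<^sub>1(1) \<alpha>\<^sub>2(1)) (erule lower, erule upper)
  show "\<forall>\<xi>\<in>c_flow_set sys. nabla (x_space sys) W (fst \<xi>) \<bullet> ideal_field sys W 1 \<xi> \<le> 0"
  proof
    fix \<xi> assume "\<xi> \<in> c_flow_set sys"
    then have "\<xi> \<in> flow_set H" by (simp add: ideal_closed_loop_def)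
    then have "fst \<xi> \<in> X" using flow_set_subset by auto
    moreover obtain p q \<theta> where "\<xi> = ((p, q), \<theta>)" by (metis prod.exhaust)
    ultimately show "nabla (x_space sys) W (fst \<xi>) \<bullet> ideal_field sys W 1 \<xi> \<le> 0"
      using nabla_ideal_field[of p q \<theta>] by (simp add: x_space sum_nonneg)
  qed
  show "\<forall>(x, \<theta>)\<in>c_jump_set sys. \<forall>(x', \<theta>')\<in>c_jump_map sys (x, \<theta>). W x' - W x \<le> 0"
  proof (intro ballI, clarsimp simp del: split_paired_All)
    fix p q \<theta> p' q' \<theta>'
    assume "((p, q), \<theta>) \<in> c_jump_set sys" "((p', q'), \<theta>') \<in> c_jump_map sys ((p, q), \<theta>)"
    then have "((p, q), \<theta>) \<in> jump_set H" "((p', q'), \<theta>') \<in> jump_map H ((p, q), \<theta>)"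
      by (simp_all add: ideal_closed_loop_def)
    from jump_cases(3)[OF this] show "V q' p' \<le> V q p" using delta_pos by auto
  qed
qed simp

lemma ideal_closed_loop_UGAS: "UGAS H (target \<times> gain_space sys)"
  unfolding gain_space
proof -
  obtain \<alpha> where \<alpha>: "class_K_inf \<alpha>" "\<forall>x\<in>X. W x \<le> \<alpha> (dist (fst x) p\<^sub>0)"
    using W_upper_bound by blast
  obtain \<eta> where \<eta>: "class_K_inf \<eta>" "\<forall>x\<in>X. dist (fst x) p\<^sub>0 \<le> \<eta> (W x)"
    using W_lower_bound by blast
  let ?K = "target \<times> \<Theta>_C \<E> T\<^sub>0"
  have dist_le: "infdist (z t j) ?K \<le> \<eta> c"
    if "hybrid_solution H E z" "(t, j) \<in> E" "W (fst (z t j)) \<le> c" for E z t j c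
  proof -
    have z: "z t j \<in> X \<times> \<Theta>_C \<E> T\<^sub>0" using solution_viable that(1,2) by blast
    then have x: "fst (z t j) \<in> X" by auto
    have "infdist (z t j) ?K \<le> \<eta> (W (fst (z t j)))"
      unfolding infdist_target_gains[OF z] using \<eta>(2) x by (rule bspec)
    also have "\<dots> \<le> \<eta> c" by (rule class_K_inf_mono[OF \<eta>(1) W_nonneg[OF x] that(3)])
    finally show ?thesis .
  qed
  have init: "(0, 0) \<in> E" "W (fst (z 0 0)) \<le> \<alpha> (infdist (z 0 0) ?K)" if "hybrid_solution H E z" for E z
  proof -
    show E: "(0, 0) \<in> E" using that by (simp add: hybrid_solution_def)
    have z: "z 0 0 \<in> X \<times> \<Theta>_C \<E> T\<^sub>0" using solution_viable that E by blast
    then have "fst (z 0 0) \<in> X" by auto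
    with \<alpha>(2) show "W (fst (z 0 0)) \<le> \<alpha> (infdist (z 0 0) ?K)"
      unfolding infdist_target_gains[OF z] by (rule bspec)
  qed
  show "UGAS H ?K"
  proof (rule UGAS_if_stable_and_uniformly_attractive[where \<alpha> = "\<lambda>r. \<eta> (\<alpha> r)"])
    show "compact ?K"
      unfolding \<Theta>_C_def using modes_finite_nonempty(1) finite_gains
      by (simp add: compact_Times finite_imp_compact)
    show "\<eta> (\<alpha> r) \<le> \<eta> (\<alpha> s)" if "0 \<le> r" "r \<le> s" for r s
      by (intro class_K_inf_mono[OF \<eta>(1)] class_K_inf_mono[OF \<alpha>(1)] class_K_inf_nonneg[OF \<alpha>(1)] that)
    have "\<forall>\<^sub>F r in at_right 0. 0 < \<alpha> r"
      using eventually_at_right_less[of 0] by eventually_elim (rule class_K_inf_pos[OF \<alpha>(1)])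
    then have "\<forall>\<^sub>F r in at_right 0. \<alpha> r \<in> {0<..} \<and> \<alpha> r \<noteq> 0" by eventually_elim simp
    then have "filterlim \<alpha> (at_right 0) (at_right 0)"
      unfolding filterlim_at using class_K_inf_tendsto_0[OF \<alpha>(1)] by blast
    then show "((\<lambda>r. \<eta> (\<alpha> r)) \<longlongrightarrow> 0) (at_right 0)"
      by (rule filterlim_compose[OF class_K_inf_tendsto_0[OF \<eta>(1)]])
    show "infdist (z t j) ?K \<le> \<eta> (\<alpha> (infdist (z 0 0) ?K))"
      if sol: "hybrid_solution H E z" and tj: "(t, j) \<in> E" for E z t j
    proof (rule dist_le[OF sol tj])
      have "0 \<le> t" using sol tj by (auto simp: hybrid_solution_def hybrid_time_domain_def)
      then show "W (fst (z t j)) \<le> \<alpha> (infdist (z 0 0) ?K)"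
        using W_nonincreasing[OF sol tj init(1)[OF sol]] init(2)[OF sol] by simp
    qed
    show "\<exists>S. \<forall>E z t j. hybrid_solution H E z \<longrightarrow> infdist (z 0 0) ?K \<le> r \<longrightarrow> (t, j) \<in> E \<longrightarrow>
        S \<le> t + real j \<longrightarrow> infdist (z t j) ?K \<le> \<epsilon>" if r: "r \<ge> 0" and \<epsilon>: "\<epsilon> > 0" for r \<epsilon>
    proof -
      have "\<forall>\<^sub>F v in at_right 0. \<eta> v < \<epsilon>" by (rule order_tendstoD(2)[OF class_K_inf_tendsto_0[OF \<eta>(1)] \<epsilon>])
      then obtain d where d: "d > 0" "\<forall>v>0. v < d \<longrightarrow> \<eta> v < \<epsilon>"
        unfolding eventually_at_right_field by auto
      have "0 < d / 2" "d / 2 < d" using d(1) by linarith+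
      then have "\<eta> (d / 2) \<le> \<epsilon>" using d(2) less_imp_le by blast
      obtain S where S: "\<forall>E z T J. hybrid_solution H E z \<longrightarrow> W (fst (z 0 0)) \<le> \<alpha> r \<longrightarrow> (T, J) \<in> E \<longrightarrow>
          S < T + real J \<longrightarrow> W (fst (z T J)) < d / 2"
        using uniform_decay_time[of "d / 2" "\<alpha> r"] d(1) class_K_inf_nonneg[OF \<alpha>(1) r] by auto
      have "infdist (z t j) ?K \<le> \<epsilon>"
        if sol: "hybrid_solution H E z" and "infdist (z 0 0) ?K \<le> r" "(t, j) \<in> E" "S + 1 \<le> t + real j"
        for E z t j
      proof -
        have "W (fst (z 0 0)) \<le> \<alpha> r"
          using init(2)[OF sol] class_K_inf_mono[OF \<alpha>(1) infdist_nonneg that(2)] by linarith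
        moreover have "S < t + real j" using that(4) by simp
        ultimately have "W (fst (z t j)) < d / 2" using S sol that(3) by blast
        then have "infdist (z t j) ?K \<le> \<eta> (d / 2)" by (intro dist_le[OF sol that(3)]) (rule less_imp_le)
        then show ?thesis using \<open>\<eta> (d / 2) \<le> \<epsilon>\<close> by (rule order_trans)
      qed
      then show ?thesis by blast
    qed
  qed
qed

end

theorem proposition5:
  fixes M :: "(real ^ 'n) set"
    and p\<^sub>0 :: "real ^ 'n"
    and b :: "'r::finite \<Rightarrow> real ^ 'n \<Rightarrow> real ^ 'n"
    and V :: "real \<Rightarrow> real ^ 'n \<Rightarrow> real"
    and N :: nat
    and \<E> :: "(real ^ 'r) set"
    and lam \<delta> T\<^sub>0 \<chi>\<^sub>1 \<chi>\<^sub>2 :: real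
  assumes "properly_embedded_manifold M" and "p\<^sub>0 \<in> M"
    and "\<And>i. C1_fun_on M (b i)"
    and "\<And>i p. p \<in> M \<Longrightarrow> b i p \<in> tangent_space M p"
    and "lam > 0"
    and "\<And>p v. p \<in> M \<Longrightarrow> v \<in> tangent_space M p \<Longrightarrow> (\<Sum>i\<in>UNIV. (b i p \<bullet> v)\<^sup>2) \<ge> lam * (v \<bullet> v)"
    and "synergistic_family M p\<^sub>0 N V \<delta>"
    and "finite \<E>" and "card \<E> \<ge> 2"
    and "T\<^sub>0 > 0" and "\<chi>\<^sub>1 > 0" and "0 < \<chi>\<^sub>2" and "\<chi>\<^sub>2 < 1"
  shows "strongly_grad_stabilizable (synergistic_system M N V \<delta> b \<E> T\<^sub>0 \<chi>\<^sub>1 \<chi>\<^sub>2)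
           (\<lambda>(p, q). V q p) ({p\<^sub>0} \<times> modes N)"
proof -
  interpret synergistic_feedback M p\<^sub>0 b V N \<E> lam \<delta> T\<^sub>0 \<chi>\<^sub>1 \<chi>\<^sub>2
    by (rule synergistic_feedback.intro) (fact assms)+
  show ?thesis
    unfolding strongly_grad_stabilizable_def
    using W_sclf_candidate ideal_closed_loop_UGAS by blast
qed

end
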